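(* Let $G$ be a graph and let $n\geq 2$. Then the discrete fundamental group $A_1(G^{(n)})$ of the $n$th reduced power of $G$ is isomorphic to the first discrete singular cubical homology group $\mathcal{H}_1(G)$.
   Context: All graphs are connected, simple and locally finite. Write $u\simeq v$ if $u,v$ are adjacent or equal. A graph map $f:G\to H$ is a function on vertices with $u\simeq v\Rightarrow f(u)\simeq f(v)$. $\mathbb{Z}$ denotes the graph on the integers with $i\sim j$ iff $|i-j|=1$; $I_m$ is its induced subgraph on $\{0,\dots,m\}$. Reduced power: $G^{(n)}$ is the quotient of the Cartesian (box) product graph $G^n$ by the action of the symmetric group $\Sigma_n$ permuting coordinates. Equivalently its vertices are degree-$n$ monomials in the vertices of $G$ (multisets of $n$ tokens on vertices of $G$, overlaps allowed), and two monomials $\mathbf{x},\mathbf{y}$ are adjacent iff $\operatorname{lcm}(\mathbf{x},\mathbf{y})/\gcd(\mathbf{x},\mathbf{y})=uv$ for some adjacent vertices $u,v$ of $G$ (i.e. they differ by moving one token along one edge). Discrete fundamental group: fix $v_0\in G$. A graph map $f:\mathbb{Z}\to G$ is based if there is $r\geq 0$ with $f(i)=v_0$ for all $|i|\geq r$; let $r_f$ be the least such $r$. A based homotopy from $f$ to $g$ is a graph map $h:\mathbb{Z}\times I_m\to G$ (box product) such that $h(\cdot,0)=f$, $h(\cdot,m)=g$ and each $h(\cdot,j)$ is a based graph map. $A_1(G)=A_1(G,v_0)$ is the set of based homotopy classes, with product $[f][g]=[p]$ where $p(i)=f(i+r_f)$ for $i\le 0$ and $p(i)=g(i-r_g)$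 for $i\ge 0$; it is independent of $v_0$ up to isomorphism. Discrete singular cubical homology: $Q_0=I_0$ and $Q_n=I_1^n$ for $n\ge1$. $\mathcal{L}_n(G)$ is the free abelian group on graph maps $f:Q_n\to G$. For $1\le k\le n$, $D_k^{\pm}f:Q_{n-1}\to G$ are obtained by inserting $0$ (for $-$) or $1$ (for $+$) in the $k$th coordinate. $f$ is degenerate if $D_k^-f=D_k^+f$ for some $k$ (no map on $Q_0$ is degenerate). $\mathcal{C}_n(G)=\mathcal{L}_n(G)/\mathcal{D}_n(G)$ where $\mathcal{D}_n$ is spanned by degenerate maps, with boundary $\partial_n f=\sum_{k=1}^n(-1)^k(D_k^-f-D_k^+f)$. Then $\mathcal{H}_n(G)=\ker\partial_n/\operatorname{im}\partial_{n+1}$. *)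

theory Defs
  imports "HOL-Library.Multiset" "HOL-Algebra.Free_Abelian_Groups"
begin

text \<open>A graph is a vertex set V with an adjacency relation E on V. Standing assumptions:
  simple (symmetric, irreflexive), locally finite, connected.\<close>

definition sgraph :: "'a set \<Rightarrow> ('a \<Rightarrow> 'a \<Rightarrow> bool) \<Rightarrow> bool" where
  "sgraph V E \<longleftrightarrow>
     (\<forall>u v. E u v \<longrightarrow> u \<in> V \<and> v \<in> V) \<and> (\<forall>u v. E u v \<longrightarrow> E v u) \<and> (\<forall>u. \<not> E u u)
     \<and> (\<forall>u\<in>V. finite {v. E u v}) \<and> (\<forall>u\<in>V. \<forall>v\<in>V. E\<^sup>*\<^sup>* u v)"

definition adj_eq :: "('a \<Rightarrow> 'a \<Rightarrow> bool) \<Rightarrow> 'a \<Rightarrow> 'a \<Rightarrow> bool" where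
  "adj_eq E u v \<longleftrightarrow> u = v \<or> E u v"

section \<open>Reduced power: degree-n monomials (multisets), moving one token along one edge\<close>

definition rpow_verts :: "'a set \<Rightarrow> nat \<Rightarrow> 'a multiset set" where
  "rpow_verts V n = {M. size M = n \<and> set_mset M \<subseteq> V}"

text \<open>lcm(x,y)/gcd(x,y) = uv with u,v adjacent, i.e. x = g u and y = g v\<close>
definition rpow_edge :: "('a \<Rightarrow> 'a \<Rightarrow> bool) \<Rightarrow> 'a multiset \<Rightarrow> 'a multiset \<Rightarrow> bool" where
  "rpow_edge E M N \<longleftrightarrow> (\<exists>u v g. E u v \<and> M = g + {#u#} \<and> N = g + {#v#})"

definition zmap :: "'a set \<Rightarrow> ('a \<Rightarrow> 'a \<Rightarrow> bool) \<Rightarrow> (int \<Rightarrow> 'a) \<Rightarrow> bool" where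
  "zmap V E f \<longleftrightarrow> (\<forall>i. f i \<in> V) \<and> (\<forall>i. adj_eq E (f i) (f (i + 1)))"

definition based :: "'a set \<Rightarrow> ('a \<Rightarrow> 'a \<Rightarrow> bool) \<Rightarrow> 'a \<Rightarrow> (int \<Rightarrow> 'a) \<Rightarrow> bool" where
  "based V E v0 f \<longleftrightarrow> zmap V E f \<and> (\<exists>r::nat. \<forall>i. \<bar>i\<bar> \<ge> int r \<longrightarrow> f i = v0)"

definition rad :: "'a \<Rightarrow> (int \<Rightarrow> 'a) \<Rightarrow> nat" where
  "rad v0 f = (LEAST r::nat. \<forall>i. \<bar>i\<bar> \<ge> int r \<longrightarrow> f i = v0)"

text \<open>based homotopy: graph map h on Z \<box> I_m (horizontal edges: each row is a based graph map;
  vertical edges: consecutive rows)\<close>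
definition based_homotopic ::
  "'a set \<Rightarrow> ('a \<Rightarrow> 'a \<Rightarrow> bool) \<Rightarrow> 'a \<Rightarrow> (int \<Rightarrow> 'a) \<Rightarrow> (int \<Rightarrow> 'a) \<Rightarrow> bool" where
  "based_homotopic V E v0 f g \<longleftrightarrow> (\<exists>(m::nat) (h::int \<Rightarrow> nat \<Rightarrow> 'a).
      (\<forall>i. h i 0 = f i) \<and> (\<forall>i. h i m = g i) \<and>
      (\<forall>j\<le>m. based V E v0 (\<lambda>i. h i j)) \<and>
      (\<forall>i j. j < m \<longrightarrow> adj_eq E (h i j) (h i (Suc j))))"

definition A1_class :: "'a set \<Rightarrow> ('a \<Rightarrow> 'a \<Rightarrow> bool) \<Rightarrow> 'a \<Rightarrow> (int \<Rightarrow> 'a) \<Rightarrow> (int \<Rightarrow> 'a) set" where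
  "A1_class V E v0 f = {g. based V E v0 g \<and> based_homotopic V E v0 f g}"

definition path_concat :: "'a \<Rightarrow> (int \<Rightarrow> 'a) \<Rightarrow> (int \<Rightarrow> 'a) \<Rightarrow> int \<Rightarrow> 'a" where
  "path_concat v0 f g = (\<lambda>i. if i \<le> 0 then f (i + int (rad v0 f)) else g (i - int (rad v0 g)))"

definition A1 :: "'a set \<Rightarrow> ('a \<Rightarrow> 'a \<Rightarrow> bool) \<Rightarrow> 'a \<Rightarrow> (int \<Rightarrow> 'a) set monoid" where
  "A1 V E v0 = \<lparr>carrier = {A1_class V E v0 f | f. based V E v0 f},
     mult = (\<lambda>X Y. A1_class V E v0 (path_concat v0 (SOME f. f \<in> X) (SOME g. g \<in> Y))),
     one = A1_class V E v0 (\<lambda>_. v0)\<rparr>"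

text \<open>Points of Q_n = I_1^n are boolean lists of length n (False = 0, True = 1).\<close>
definition cube_pts :: "nat \<Rightarrow> bool list set" where
  "cube_pts n = {p. length p = n}"

definition cube_adj_eq :: "bool list \<Rightarrow> bool list \<Rightarrow> bool" where
  "cube_adj_eq p q \<longleftrightarrow> length p = length q \<and> card {i. i < length p \<and> p ! i \<noteq> q ! i} \<le> 1"

definition cube_map :: "'a set \<Rightarrow> ('a \<Rightarrow> 'a \<Rightarrow> bool) \<Rightarrow> nat \<Rightarrow> (bool list \<Rightarrow> 'a) \<Rightarrow> bool" where
  "cube_map V E n f \<longleftrightarrow> f \<in> extensional (cube_pts n) \<and> (\<forall>p\<in>cube_pts n. f p \<in> V) \<and>
     (\<forall>p\<in>cube_pts n. \<forall>q\<in>cube_pts n. cube_adj_eq p q \<longrightarrow> adj_eq E (f p) (f q))"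

definition cubes :: "'a set \<Rightarrow> ('a \<Rightarrow> 'a \<Rightarrow> bool) \<Rightarrow> nat \<Rightarrow> (bool list \<Rightarrow> 'a) set" where
  "cubes V E n = {f. cube_map V E n f}"

definition face :: "nat \<Rightarrow> nat \<Rightarrow> bool \<Rightarrow> (bool list \<Rightarrow> 'a) \<Rightarrow> (bool list \<Rightarrow> 'a)" where
  "face n k b f = restrict (\<lambda>p. f (take (k - 1) p @ b # drop (k - 1) p)) (cube_pts (n - 1))"

definition degenerate :: "nat \<Rightarrow> (bool list \<Rightarrow> 'a) \<Rightarrow> bool" where
  "degenerate n f \<longleftrightarrow> (\<exists>k\<in>{1..n}. face n k False f = face n k True f)"

definition cube_bd :: "nat \<Rightarrow> (bool list \<Rightarrow> 'a) \<Rightarrow> (bool list \<Rightarrow> 'a) \<Rightarrow>\<^sub>0 int" where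
  "cube_bd n f = (\<Sum>k\<in>{1..n}. frag_cmul ((-1) ^ k) (frag_of (face n k False f) - frag_of (face n k True f)))"

definition Lgrp :: "'a set \<Rightarrow> ('a \<Rightarrow> 'a \<Rightarrow> bool) \<Rightarrow> nat \<Rightarrow> ((bool list \<Rightarrow> 'a) \<Rightarrow>\<^sub>0 int) monoid" where
  "Lgrp V E n = free_Abelian_group (cubes V E n)"

definition Dgrp :: "'a set \<Rightarrow> ('a \<Rightarrow> 'a \<Rightarrow> bool) \<Rightarrow> nat \<Rightarrow> ((bool list \<Rightarrow> 'a) \<Rightarrow>\<^sub>0 int) set" where
  "Dgrp V E n = generate (Lgrp V E n) (frag_of ` {f \<in> cubes V E n. degenerate n f})"

definition Cgrp :: "'a set \<Rightarrow> ('a \<Rightarrow> 'a \<Rightarrow> bool) \<Rightarrow> nat \<Rightarrow> ((bool list \<Rightarrow> 'a) \<Rightarrow>\<^sub>0 int) set monoid" where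
  "Cgrp V E n = Lgrp V E n Mod Dgrp V E n"

text \<open>boundary on L_n, and the induced boundary C_n \<rightarrow> C_{n-1} (via any representative)\<close>
definition bdL :: "nat \<Rightarrow> ((bool list \<Rightarrow> 'a) \<Rightarrow>\<^sub>0 int) \<Rightarrow> ((bool list \<Rightarrow> 'a) \<Rightarrow>\<^sub>0 int)" where
  "bdL n = frag_extend (cube_bd n)"

definition bdC :: "'a set \<Rightarrow> ('a \<Rightarrow> 'a \<Rightarrow> bool) \<Rightarrow> nat \<Rightarrow>
     ((bool list \<Rightarrow> 'a) \<Rightarrow>\<^sub>0 int) set \<Rightarrow> ((bool list \<Rightarrow> 'a) \<Rightarrow>\<^sub>0 int) set" where
  "bdC V E n X = r_coset (Lgrp V E (n - 1)) (Dgrp V E (n - 1)) (bdL n (SOME c. c \<in> X))"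

definition H1 :: "'a set \<Rightarrow> ('a \<Rightarrow> 'a \<Rightarrow> bool) \<Rightarrow> ((bool list \<Rightarrow> 'a) \<Rightarrow>\<^sub>0 int) set set monoid" where
  "H1 V E = subgroup_generated (Cgrp V E 1) (kernel (Cgrp V E 1) (Cgrp V E 0) (bdC V E 1))
            Mod (bdC V E 2 ` carrier (Cgrp V E 2))"

end

(*
  Recording the edge along which a token moves turns a loop in the reduced power into a 1-cycle of G.
  Around a square of the reduced power four tokens move, and their sources and targets agree as
  multisets; the moves therefore split into closed walks of length at most four in G, which bound.
  So homotopic loops give homologous cycles.

  Conversely, fix a root a and a walk from a to every vertex, so that an edge uv gives a closed walk
  at a. Running it with a single token, the others resting at a, gives a loop in the reduced power.
  Different tokens move independently, and with at least two tokens these loops therefore commute,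
  so they define a homomorphism on 1-chains, which kills boundaries. Since all tokens can be brought
  back to a after every move, each loop is homotopic to the product of the one-token loops of its
  moves, hence determined by its homology class.
*)
theory Submission
  imports Defs
begin

section \<open>Homotopy of lazy walks\<close>

text \<open>A based map on the integers is awkward to cut and glue, since every concatenation brings
  shifts. The argument therefore runs on finite lists of vertices; based maps enter only where a
  window of values is cut out or a list is extended by the base point. The relation on lists is a
  congruence for append that asks nothing of the pieces, so a homotopy may be applied anywhere
  inside a longer walk. The two sides match because both kill the same short cycles: a square with
  possibly equal corners contracts backtracks, triangles and 4-cycles in homotopy, and bounds them
  in homology. Four is also the number of moves around a square of the reduced power. The obstacle
  in the converse is that a monomial does not order its tokens. A walk from the root monomial to it
  needs an order; the swap of two tokens, which also gives commutativity, makes the choice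
  immaterial up to homotopy. The homomorphism on chains is not a literal inverse: it recovers a walk
  up to conjugation by the walk from the root monomial to the base point. That is enough for
  injectivity; surjectivity is shown by building loops from chains.\<close>

abbreviation walk :: "('v \<Rightarrow> 'v \<Rightarrow> bool) \<Rightarrow> 'v list \<Rightarrow> bool" where
  "walk R \<equiv> successively (adj_eq R)"

text \<open>Walks may pause, so two walks with a common endpoint are concatenated by plain append;
  the relation is the congruence generated by removing a pause and by pushing across a
  (possibly degenerate) square.\<close>

inductive walk_homotopic :: "('v \<Rightarrow> 'v \<Rightarrow> bool) \<Rightarrow> 'v list \<Rightarrow> 'v list \<Rightarrow> bool"
  for R :: "'v \<Rightarrow> 'v \<Rightarrow> bool" where
  refl: "walk_homotopic R p p"
| sym: "walk_homotopic R p q \<Longrightarrow> walk_homotopic R q p"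
| trans: "walk_homotopic R p q \<Longrightarrow> walk_homotopic R q r \<Longrightarrow> walk_homotopic R p r"
| pause: "walk_homotopic R [x] [x, x]"
| square: "\<lbrakk>adj_eq R x y; adj_eq R y z; adj_eq R x y'; adj_eq R y' z\<rbrakk>
    \<Longrightarrow> walk_homotopic R [x, y, z] [x, y', z]"
| append: "\<lbrakk>walk_homotopic R p q; walk_homotopic R p' q'\<rbrakk>
    \<Longrightarrow> walk_homotopic R (p @ p') (q @ q')"

declare walk_homotopic.trans [trans]

lemma adj_eq_refl [simp]: "adj_eq R x x"
  by (simp add: adj_eq_def)

lemma adj_eq_sym: "symp R \<Longrightarrow> adj_eq R x y \<Longrightarrow> adj_eq R y x"
  by (auto simp: adj_eq_def dest: sympD)

lemma walk_homotopic_ends: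
  "walk_homotopic R p q \<Longrightarrow> (p = [] \<longleftrightarrow> q = []) \<and> hd p = hd q \<and> last p = last q"
  by (induction rule: walk_homotopic.induct) (auto simp: hd_append last_append)

text \<open>Being a walk is decided inside the pieces and at their seams, and a homotopy fixes the
  endpoints of each piece. This is why the rule \<open>append\<close> can do without walk
  hypotheses.\<close>

lemma walk_homotopic_walk: "walk_homotopic R p q \<Longrightarrow> walk R p \<longleftrightarrow> walk R q"
proof (induction rule: walk_homotopic.induct)
  case (append p q p' q')
  with walk_homotopic_ends[of R p q] walk_homotopic_ends[of R p' q'] show ?case
    by (simp add: successively_append_iff)
qed auto

lemma walk_homotopic_map:
  assumes "\<And>x y. adj_eq R x y \<Longrightarrow> adj_eq S (f x) (f y)"
  shows "walk_homotopic R p q \<Longrightarrow> walk_homotopic S (map f p) (map f q)"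
proof (induction rule: walk_homotopic.induct)
  case (trans p q r)
  then show ?case by (blast intro: walk_homotopic.trans)
qed (simp_all add: walk_homotopic.refl walk_homotopic.sym walk_homotopic.pause
  walk_homotopic.square walk_homotopic.append assms)

lemma walk_homotopic_rev:
  assumes "symp R"
  shows "walk_homotopic R p q \<Longrightarrow> walk_homotopic R (rev p) (rev q)"
proof (induction rule: walk_homotopic.induct)
  case (trans p q r)
  then show ?case by (blast intro: walk_homotopic.trans)
qed (simp_all add: walk_homotopic.refl walk_homotopic.sym walk_homotopic.pause
  walk_homotopic.square walk_homotopic.append adj_eq_sym[OF assms])

lemma walk_map:
  assumes "\<And>x y. adj_eq R x y \<Longrightarrow> adj_eq S (f x) (f y)"
  shows "walk R p \<Longrightarrow> walk S (map f p)"
  by (induction p rule: induct_list012) (auto intro: assms)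

lemma walk_rev: "symp R \<Longrightarrow> walk R p \<Longrightarrow> walk R (rev p)"
  by (metis (mono_tags, lifting) adj_eq_sym successively_mono successively_rev)

lemma walk_pad: "walk R w \<Longrightarrow> w \<noteq> [] \<Longrightarrow> hd w = x \<Longrightarrow> last w = x \<Longrightarrow> walk R (x # w @ [x])"
  by (simp add: successively_Cons successively_append_iff)

lemma walk_homotopic_append1: "walk_homotopic R p q \<Longrightarrow> walk_homotopic R (p @ r) (q @ r)"
  by (intro walk_homotopic.append walk_homotopic.refl)

lemma walk_homotopic_append2: "walk_homotopic R p q \<Longrightarrow> walk_homotopic R (r @ p) (r @ q)"
  by (intro walk_homotopic.append walk_homotopic.refl)

lemma walk_homotopic_Cons_hd:
  assumes "q \<noteq> []" shows "walk_homotopic R (hd q # q) q"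
proof (cases q)
  case (Cons x r)
  have "walk_homotopic R ([x, x] @ r) ([x] @ r)"
    by (intro walk_homotopic_append1 walk_homotopic.sym[OF walk_homotopic.pause])
  then show ?thesis using Cons by simp
qed (use assms in simp)

lemma walk_homotopic_snoc_last:
  assumes "q \<noteq> []" shows "walk_homotopic R (q @ [last q]) q"
proof (cases q rule: rev_cases)
  case (snoc r x)
  have "walk_homotopic R (r @ [x, x]) (r @ [x])"
    by (intro walk_homotopic_append2 walk_homotopic.sym[OF walk_homotopic.pause])
  then show ?thesis using snoc by simp
qed (use assms in simp)

text \<open>Contract from the turning point outwards: the inner excursion shrinks to
  \<open>hd p\<close>, and the remaining step out and back is one path of a square with three equal
  corners.\<close>

lemma walk_homotopic_append_rev:
  assumes "symp R"
  shows "walk R p \<Longrightarrow> p \<noteq> [] \<Longrightarrow> walk_homotopic R (p @ rev p) [hd p]"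
proof (induction p)
  case (Cons x p)
  show ?case
  proof (cases "p = []")
    case True
    then show ?thesis by (simp add: walk_homotopic.sym[OF walk_homotopic.pause])
  next
    case False
    then have adj: "adj_eq R x (hd p)" and w: "walk R p"
      using Cons.prems by (auto simp: successively_Cons)
    have "walk_homotopic R ([x] @ (p @ rev p) @ [x]) ([x] @ [hd p] @ [x])"
      by (intro walk_homotopic_append1 walk_homotopic_append2 Cons.IH w False)
    also have "walk_homotopic R ([x] @ [hd p] @ [x]) [x, x, x]"
      using adj adj_eq_sym[OF assms adj] by (auto intro: walk_homotopic.square)
    also have "walk_homotopic R [x, x, x] [x]"
      using walk_homotopic_Cons_hd[of "[x, x]"] walk_homotopic_Cons_hd[of "[x]"]
      by (metis list.sel(1) list.distinct(1) walk_homotopic.trans)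
    finally show ?thesis by simp
  qed
qed simp

lemma walk_homotopic_rev_append:
  assumes "symp R" "walk R p" "p \<noteq> []"
  shows "walk_homotopic R (rev p @ p) [last p]"
  using walk_homotopic_append_rev[OF assms(1) walk_rev[OF assms(1,2)]] assms(3)
  by (simp add: hd_rev)

text \<open>Two parallel copies of a walk \<open>q\<close> bound a strip of squares.\<close>
lemma walk_homotopic_ladder:
  assumes fg: "\<And>x. adj_eq S (f x) (g x)"
    and f: "\<And>x y. adj_eq R x y \<Longrightarrow> adj_eq S (f x) (f y)"
    and g: "\<And>x y. adj_eq R x y \<Longrightarrow> adj_eq S (g x) (g y)"
  shows "walk R q \<Longrightarrow> q \<noteq> [] \<Longrightarrow>
    walk_homotopic S (f (hd q) # map g q) (map f q @ [g (last q)])"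
proof (induction q)
  case (Cons x q)
  show ?case
  proof (cases "q = []")
    case True
    then show ?thesis by (simp add: walk_homotopic.refl)
  next
    case False
    then have adj: "adj_eq R x (hd q)" and w: "walk R q"
      using Cons.prems by (auto simp: successively_Cons)
    have q: "map g q = g (hd q) # map g (tl q)"
      using False by (metis list.collapse list.simps(9))
    have "walk_homotopic S ([f x, g x, g (hd q)] @ map g (tl q))
        ([f x, f (hd q), g (hd q)] @ map g (tl q))"
      by (intro walk_homotopic_append1 walk_homotopic.square fg f g adj)
    also have "\<dots> = [f x] @ (f (hd q) # map g q)" by (simp add: q)
    also have "walk_homotopic S \<dots> ([f x] @ (map f q @ [g (last q)]))"
      by (intro walk_homotopic_append2 Cons.IH w False)
    finally show ?thesis using False by (simp add: q)
  qed
qed simp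

section \<open>Based loops and closed walks\<close>

lemma based_homotopic_refl: "based W R v0 f \<Longrightarrow> based_homotopic W R v0 f f"
  unfolding based_homotopic_def by (rule exI[of _ 0], rule exI[of _ "\<lambda>i j. f i"]) auto

lemma based_homotopic_step:
  assumes "based W R v0 f" "based W R v0 g" "\<And>i. adj_eq R (f i) (g i)"
  shows "based_homotopic W R v0 f g"
  unfolding based_homotopic_def
  by (rule exI[of _ 1], rule exI[of _ "\<lambda>i j. if j = 0 then f i else g i"])
    (use assms in \<open>auto simp: le_Suc_eq\<close>)

lemma based_homotopic_sym:
  assumes "symp R" "based_homotopic W R v0 f g"
  shows "based_homotopic W R v0 g f"
proof -
  obtain m and h :: "int \<Rightarrow> nat \<Rightarrow> 'a" where h: "\<forall>i. h i 0 = f i" "\<forall>i. h i m = g i"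
      "\<forall>j\<le>m. based W R v0 (\<lambda>i. h i j)" "\<forall>i j. j < m \<longrightarrow> adj_eq R (h i j) (h i (Suc j))"
    using assms(2) unfolding based_homotopic_def by blast
  have "adj_eq R (h i (m - j)) (h i (m - Suc j))" if "j < m" for i j
  proof -
    have "m - j = Suc (m - Suc j)" "m - Suc j < m" using that by auto
    then show ?thesis using h(4) adj_eq_sym[OF assms(1)] by metis
  qed
  then show ?thesis unfolding based_homotopic_def
    by (intro exI[of _ m] exI[of _ "\<lambda>i j. h i (m - j)"]) (use h in auto)
qed

lemma based_homotopic_trans:
  assumes "based_homotopic W R v0 f g" "based_homotopic W R v0 g k"
  shows "based_homotopic W R v0 f k"
proof -
  obtain m and h :: "int \<Rightarrow> nat \<Rightarrow> 'a" where h: "\<forall>i. h i 0 = f i" "\<forall>i. h i m = g i"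
      "\<forall>j\<le>m. based W R v0 (\<lambda>i. h i j)" "\<forall>i j. j < m \<longrightarrow> adj_eq R (h i j) (h i (Suc j))"
    using assms(1) unfolding based_homotopic_def by blast
  obtain m' and h' :: "int \<Rightarrow> nat \<Rightarrow> 'a" where h': "\<forall>i. h' i 0 = g i" "\<forall>i. h' i m' = k i"
      "\<forall>j\<le>m'. based W R v0 (\<lambda>i. h' i j)" "\<forall>i j. j < m' \<longrightarrow> adj_eq R (h' i j) (h' i (Suc j))"
    using assms(2) unfolding based_homotopic_def by blast
  define H where "H = (\<lambda>i j. if j \<le> m then h i j else h' i (j - m))"
  have "adj_eq R (H i j) (H i (Suc j))" if "j < m + m'" for i j
  proof (cases "j < m")
    case True then show ?thesis using h(4) by (simp add: H_def)
  next
    case False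
    then have "H i j = h' i (j - m)" using h(2) h'(1) by (auto simp: H_def)
    moreover have "H i (Suc j) = h' i (Suc (j - m))" using False by (auto simp: H_def Suc_diff_le)
    ultimately show ?thesis using h'(4) that False by auto
  qed
  moreover have "based W R v0 (\<lambda>i. H i j)" if "j \<le> m + m'" for j
    using h(3) h'(3) that by (cases "j \<le> m") (auto simp: H_def)
  moreover have "H i (m + m') = k i" for i
    using h(2) h'(1,2) by (cases "m' = 0") (auto simp: H_def)
  ultimately show ?thesis unfolding based_homotopic_def
    by (intro exI[of _ "m + m'"] exI[of _ H]) (use h(1) in \<open>auto simp: H_def\<close>)
qed

declare based_homotopic_trans [trans]

lemma based_homotopic_based:
  assumes "based_homotopic W R v0 f g" shows "based W R v0 f" "based W R v0 g"
proof -
  obtain m and h :: "int \<Rightarrow> nat \<Rightarrow> 'a" where h: "\<forall>i. h i 0 = f i" "\<forall>i. h i m = g i"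
      "\<forall>j\<le>m. based W R v0 (\<lambda>i. h i j)"
    using assms unfolding based_homotopic_def by blast
  then show "based W R v0 f" "based W R v0 g"
    using h(3)[rule_format, of 0] h(3)[rule_format, of m] by simp_all
qed

lemma A1_class_eq_iff:
  assumes "symp R" "based W R v0 f" "based W R v0 g"
  shows "A1_class W R v0 f = A1_class W R v0 g \<longleftrightarrow> based_homotopic W R v0 f g"
proof
  assume "A1_class W R v0 f = A1_class W R v0 g"
  moreover have "g \<in> A1_class W R v0 g"
    using assms(3) based_homotopic_refl by (simp add: A1_class_def)
  ultimately have "g \<in> A1_class W R v0 f" by simp
  then show "based_homotopic W R v0 f g" by (simp add: A1_class_def)
next
  assume h: "based_homotopic W R v0 f g"
  then show "A1_class W R v0 f = A1_class W R v0 g"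
    using based_homotopic_trans[OF h] based_homotopic_trans[OF based_homotopic_sym[OF assms(1) h]]
    by (auto simp: A1_class_def)
qed

lemma based_shift:
  assumes "based W R v0 f" shows "based W R v0 (\<lambda>i. f (i + c))"
proof -
  from assms obtain r :: nat where z: "zmap W R f" and r: "\<forall>i. \<bar>i\<bar> \<ge> int r \<longrightarrow> f i = v0"
    by (auto simp: based_def)
  have "zmap W R (\<lambda>i. f (i + c))"
    using z by (auto simp: zmap_def) (metis add.commute add.left_commute)
  moreover have "\<forall>i. \<bar>i\<bar> \<ge> int (r + nat \<bar>c\<bar>) \<longrightarrow> f (i + c) = v0"
    using r by auto
  ultimately show ?thesis unfolding based_def by blast
qed

text \<open>Consecutive values are adjacent or equal, so a delay by one time unit is a homotopy in
  one step.\<close>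

lemma based_homotopic_shift:
  assumes "based W R v0 f" shows "based_homotopic W R v0 (\<lambda>i. f (i - int k)) f"
proof (induction k)
  case 0 then show ?case using based_homotopic_refl[OF assms] by simp
next
  case (Suc k)
  have "based_homotopic W R v0 (\<lambda>i. f (i - int (Suc k))) (\<lambda>i. f (i - int k))"
  proof (rule based_homotopic_step)
    show "adj_eq R (f (i - int (Suc k))) (f (i - int k))" for i
    proof -
      have "i - int k = (i - int (Suc k)) + 1" by simp
      then show ?thesis using assms unfolding based_def zmap_def by metis
    qed
    show "based W R v0 (\<lambda>i. f (i - int (Suc k)))" "based W R v0 (\<lambda>i. f (i - int k))"
      using based_shift[OF assms, of "- int (Suc k)"] based_shift[OF assms, of "- int k"]
      by (simp_all only: diff_conv_add_uminus)
  qed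
  from based_homotopic_trans[OF this Suc.IH] show ?case .
qed

lemma rad_spec:
  assumes "based W R v0 f" "\<bar>i\<bar> \<ge> int (rad v0 f)" shows "f i = v0"
proof -
  have "\<exists>r::nat. \<forall>i. \<bar>i\<bar> \<ge> int r \<longrightarrow> f i = v0" using assms(1) by (auto simp: based_def)
  from LeastI_ex[OF this] show ?thesis using assms(2) unfolding rad_def by blast
qed

lemma based_path_concat:
  assumes f: "based W R v0 f" and g: "based W R v0 g"
  shows "based W R v0 (path_concat v0 f g)"
proof -
  define rf rg where "rf = int (rad v0 f)" and "rg = int (rad v0 g)"
  have f0: "f i = v0" if "\<bar>i\<bar> \<ge> rf" for i using rad_spec[OF f] that by (simp add: rf_def)
  have g0: "g i = v0" if "\<bar>i\<bar> \<ge> rg" for i using rad_spec[OF g] that by (simp add: rg_def)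
  have nonneg: "rf \<ge> 0" "rg \<ge> 0" by (auto simp: rf_def rg_def)
  let ?p = "path_concat v0 f g"
  have p1: "?p i = f (i + rf)" if "i \<le> 0" for i using that by (simp add: path_concat_def rf_def)
  \<comment> \<open>At 0 both halves have the value \<open>v0\<close>, so the second formula already
    holds there; the seam between 0 and 1 requires this.\<close>
  have p2: "?p i = g (i - rg)" if "i \<ge> 0" for i
    using that f0[of rf] g0[of "- rg"] nonneg
      by (cases "i = 0") (auto simp: path_concat_def rf_def rg_def)
  have "adj_eq R (?p i) (?p (i + 1))" for i
  proof (cases "i < 0")
    case True
    have "adj_eq R (f (i + rf)) (f (i + rf + 1))" using f unfolding based_def zmap_def by blast
    then show ?thesis using True p1[of i] p1[of "i + 1"] by (simp add: algebra_simps)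
  next
    case False
    have "adj_eq R (g (i - rg)) (g (i - rg + 1))" using g unfolding based_def zmap_def by blast
    then show ?thesis using False p2[of i] p2[of "i + 1"] by (simp add: algebra_simps)
  qed
  moreover have "?p i \<in> W" for i
    using f g by (simp add: path_concat_def based_def zmap_def)
  \<comment> \<open>The halves are shifted by the radii, so values other than \<open>v0\<close>
    occur only between \<open>-2 * rf\<close> and \<open>2 * rg\<close>.\<close>
  moreover have "\<forall>i. \<bar>i\<bar> \<ge> int (2 * rad v0 f + 2 * rad v0 g) \<longrightarrow> ?p i = v0"
  proof (intro allI impI)
    fix i assume i: "\<bar>i\<bar> \<ge> int (2 * rad v0 f + 2 * rad v0 g)"
    show "?p i = v0"
    proof (cases "i \<le> 0")
      case True
      then show ?thesis using i p1[of i] f0[of "i + rf"] by (simp add: rf_def)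
    next
      case False
      then show ?thesis using i p2[of i] g0[of "i - rg"] by (simp add: rg_def)
    qed
  qed
  ultimately show ?thesis unfolding based_def zmap_def by blast
qed

definition walk_loop :: "'v \<Rightarrow> 'v list \<Rightarrow> int \<Rightarrow> 'v" where
  "walk_loop v0 w i = (if 0 \<le> i \<and> i < int (length w) then w ! nat i else v0)"

text \<open>The list \<open>w\<close> need not begin or end at \<open>v0\<close>: its ends only have
  to be adjacent or equal to \<open>v0\<close>, which is what the padded list expresses.\<close>

lemma based_walk_loop:
  assumes "walk R (v0 # w @ [v0])" "set w \<subseteq> W" "v0 \<in> W"
  shows "based W R v0 (walk_loop v0 w)"
proof -
  \<comment> \<open>The padded list is read from time -1 on, hence the index
    \<open>i + 1\<close>.\<close>
  have eq: "walk_loop v0 w i = (v0 # w @ [v0]) ! nat (i + 1)" if "-1 \<le> i" "i \<le> int (length w)" for i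
  proof (cases "i = -1")
    case False
    then have "nat (i + 1) = Suc (nat i)" using that by auto
    then show ?thesis using that False by (auto simp: walk_loop_def nth_append nth_Cons')
  qed (simp add: walk_loop_def)
  have "adj_eq R (walk_loop v0 w i) (walk_loop v0 w (i + 1))" for i
  proof (cases "-1 \<le> i \<and> i < int (length w)")
    case True
    moreover have "nat (i + 1 + 1) = Suc (nat (i + 1))" using True by auto
    moreover have "Suc (nat (i + 1)) < length (v0 # w @ [v0])" using True by auto
    ultimately show ?thesis
      using assms(1)[unfolded successively_conv_nth, rule_format, of "nat (i + 1)"]
        eq[of i] eq[of "i + 1"] by simp
  qed (auto simp: walk_loop_def)
  moreover have "walk_loop v0 w i \<in> W" for i
    using assms(2,3) by (auto simp: walk_loop_def subset_iff)
  moreover have "\<forall>i. \<bar>i\<bar> \<ge> int (Suc (length w)) \<longrightarrow> walk_loop v0 w i = v0"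
    by (auto simp: walk_loop_def)
  ultimately show ?thesis unfolding based_def zmap_def by blast
qed

text \<open>A pause delays the rest of the loop by one. Up to the pause the two loops agree, and
  after it their values are consecutive values of a single loop.\<close>

lemma walk_loop_pause:
  assumes "walk R (v0 # u @ [x] @ v @ [v0])" "set (u @ [x] @ v) \<subseteq> W" "v0 \<in> W"
  shows "based_homotopic W R v0 (walk_loop v0 (u @ [x, x] @ v)) (walk_loop v0 (u @ [x] @ v))"
proof (rule based_homotopic_step)
  have b: "based W R v0 (walk_loop v0 (u @ [x] @ v))"
    by (rule based_walk_loop) (use assms in auto)
  then show "based W R v0 (walk_loop v0 (u @ [x] @ v))" .
  show "based W R v0 (walk_loop v0 (u @ [x, x] @ v))"
  proof (rule based_walk_loop)
    have "walk_homotopic R ((v0 # u) @ [x] @ v @ [v0]) ((v0 # u) @ [x, x] @ v @ [v0])"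
      by (intro walk_homotopic_append1 walk_homotopic_append2 walk_homotopic.pause)
    then show "walk R (v0 # (u @ [x, x] @ v) @ [v0])"
      using assms(1) walk_homotopic_walk by fastforce
  qed (use assms in auto)
  fix i
  have "walk_loop v0 (u @ [x, x] @ v) i =
    walk_loop v0 (u @ [x] @ v) (if i \<le> int (length u) then i else i - 1)"
  proof (cases "i \<le> int (length u)")
    case False
    then have "nat i = Suc (nat (i - 1))" "nat (i - 1) \<ge> length u" by auto
    then show ?thesis using False
      by (auto simp: walk_loop_def nth_append nth_Cons')
  qed (auto simp: walk_loop_def nth_append nth_Cons')
  moreover have "adj_eq R (walk_loop v0 (u @ [x] @ v) (i - 1)) (walk_loop v0 (u @ [x] @ v) (i - 1 + 1))"
    using b unfolding based_def zmap_def by blast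
  ultimately show "adj_eq R (walk_loop v0 (u @ [x, x] @ v) i) (walk_loop v0 (u @ [x] @ v) i)"
    by (simp split: if_splits)
qed

lemma walk_loop_step:
  assumes "list_all2 (adj_eq R) w w'" "based W R v0 (walk_loop v0 w)" "based W R v0 (walk_loop v0 w')"
  shows "based_homotopic W R v0 (walk_loop v0 w) (walk_loop v0 w')"
proof (rule based_homotopic_step)
  show "adj_eq R (walk_loop v0 w i) (walk_loop v0 w' i)" for i
    using assms(1) by (auto simp: walk_loop_def list_all2_conv_all_nth)
qed (use assms in auto)

locale symmetric_graph =
  fixes W :: "'v set" and R :: "'v \<Rightarrow> 'v \<Rightarrow> bool"
  assumes symR: "symp R" and R_closed: "\<And>x y. R x y \<Longrightarrow> x \<in> W \<Longrightarrow> y \<in> W"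
begin

lemma walk_in_verts: "walk R (x # w) \<Longrightarrow> x \<in> W \<Longrightarrow> set w \<subseteq> W"
  by (induction w arbitrary: x) (auto simp: adj_eq_def intro: R_closed)

lemma walk_loop_homotopic:
  assumes "walk_homotopic R p q" "v0 \<in> W" "walk R (v0 # u @ p @ v @ [v0])"
  shows "based_homotopic W R v0 (walk_loop v0 (u @ p @ v)) (walk_loop v0 (u @ q @ v))"
proof -
  have based_loop: "based W R v0 (walk_loop v0 w)" if "walk R (v0 # w @ [v0])" for w
    using walk_in_verts[OF that assms(2)] that assms(2) by (intro based_walk_loop) auto
  have transfer: "walk R (v0 # u @ q @ v @ [v0])"
    if "walk_homotopic R p q" "walk R (v0 # u @ p @ v @ [v0])" for p q u v
    using walk_homotopic_walk[of R "(v0 # u) @ p @ v @ [v0]" "(v0 # u) @ q @ v @ [v0]"] that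
    by (simp add: walk_homotopic_append1 walk_homotopic_append2 flip: append_Cons)
  \<comment> \<open>The contexts \<open>u\<close> and \<open>v\<close> are quantified because each
    half of an \<open>append\<close> has the other half as part of its context.\<close>
  have "\<forall>u v. walk R (v0 # u @ p @ v @ [v0]) \<longrightarrow>
      based_homotopic W R v0 (walk_loop v0 (u @ p @ v)) (walk_loop v0 (u @ q @ v))"
    using assms(1)
  proof (induction rule: walk_homotopic.induct)
    case (refl p)
    show ?case
      using based_loop[of "_ @ p @ _"] by (auto intro!: based_homotopic_refl)
  next
    case (sym p q)
    then show ?case by (meson based_homotopic_sym symR transfer walk_homotopic.sym)
  next
    case (trans p q r)
    then show ?case by (meson based_homotopic_trans transfer)
  next
    case (pause x)
    show ?case
    proof (intro allI impI)
      fix u v assume w: "walk R (v0 # u @ [x] @ v @ [v0])"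
      have "set (u @ [x] @ v) \<subseteq> W" using walk_in_verts[OF w assms(2)] by auto
      from based_homotopic_sym[OF symR walk_loop_pause[OF w this assms(2)]]
      show "based_homotopic W R v0 (walk_loop v0 (u @ [x] @ v)) (walk_loop v0 (u @ [x, x] @ v))" .
    qed
  next
    case (square x y z y')
    show ?case
    proof (intro allI impI)
      fix u v assume w: "walk R (v0 # u @ [x, y, z] @ v @ [v0])"
      have w': "walk R (v0 # u @ [x, y', z] @ v @ [v0])"
        using transfer[OF _ w] walk_homotopic.square[OF square] by blast
      have s: "set (u @ [x, y, z] @ v) \<subseteq> W" using walk_in_verts[OF w assms(2)] by auto
      have s': "set (u @ [x, y', z] @ v) \<subseteq> W" using walk_in_verts[OF w' assms(2)] by auto
      have e: "(u @ [x, y]) @ [z, z] @ v = u @ [x, y, z, z] @ v"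
        "u @ [x, x] @ [y', z] @ v = u @ [x, x, y', z] @ v" by auto
      have p: "based_homotopic W R v0 (walk_loop v0 ((u @ [x, y]) @ [z, z] @ v))
        (walk_loop v0 ((u @ [x, y]) @ [z] @ v))"
        using w s assms(2) by (intro walk_loop_pause) auto
      have p': "based_homotopic W R v0 (walk_loop v0 (u @ [x, x] @ [y', z] @ v))
        (walk_loop v0 (u @ [x] @ [y', z] @ v))"
        using w' s' assms(2) by (intro walk_loop_pause) auto
      \<comment> \<open>The corners \<open>y\<close> and \<open>y'\<close> need not be adjacent.
        Pausing at \<open>z\<close> in one walk and at \<open>x\<close> in the other makes the two
        adjacent or equal position by position.\<close>
      have "based_homotopic W R v0 (walk_loop v0 (u @ [x, y, z, z] @ v))
        (walk_loop v0 (u @ [x, x, y', z] @ v))"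
      proof (rule walk_loop_step)
        have "adj_eq R y x" "adj_eq R z y'" using square symR by (auto intro: adj_eq_sym)
        then show "list_all2 (adj_eq R) (u @ [x, y, z, z] @ v) (u @ [x, x, y', z] @ v)"
          by (intro list_all2_appendI) (auto intro: list_all2_refl)
      qed (use based_homotopic_based(1)[OF p] based_homotopic_based(1)[OF p'] in \<open>auto simp: e\<close>)
      with p p' show "based_homotopic W R v0 (walk_loop v0 (u @ [x, y, z] @ v))
        (walk_loop v0 (u @ [x, y', z] @ v))"
        unfolding e by (metis append.assoc append_Cons append_Nil based_homotopic_sym
            based_homotopic_trans symR)
    qed
  next
    case (append p q p' q')
    show ?case
    proof (intro allI impI)
      fix u v assume w: "walk R (v0 # u @ (p @ p') @ v @ [v0])"
      then have "based_homotopic W R v0 (walk_loop v0 (u @ p @ (p' @ v)))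
        (walk_loop v0 (u @ q @ (p' @ v)))"
        using append.IH(1) by (metis append_assoc)
      moreover have "walk R (v0 # u @ q @ (p' @ v) @ [v0])"
        using transfer[OF append.hyps(1), of u "p' @ v"] w by simp
      then have "based_homotopic W R v0 (walk_loop v0 ((u @ q) @ p' @ v))
        (walk_loop v0 ((u @ q) @ q' @ v))"
        using append.IH(2) by (metis append_assoc)
      ultimately show "based_homotopic W R v0 (walk_loop v0 (u @ (p @ p') @ v))
        (walk_loop v0 (u @ (q @ q') @ v))"
        by (metis append_assoc based_homotopic_trans)
    qed
  qed
  then show ?thesis using assms(3) by blast
qed

end

section \<open>Cutting a based map to a finite walk\<close>

definition window :: "nat \<Rightarrow> (int \<Rightarrow> 'v) \<Rightarrow> 'v list" where
  "window r f = map (\<lambda>k. f (int k - int r)) [0..<2 * r + 1]"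

text \<open>The window begins at time \<open>- r\<close> and \<open>walk_loop\<close> at time 0,
  hence the shift in the last clause. The bound \<open>r\<close> is free so that two maps can be cut
  to the same interval.\<close>

lemma window_props:
  assumes "based W R v0 f" "\<forall>i. \<bar>i\<bar> \<ge> int r \<longrightarrow> f i = v0"
  shows "walk R (window r f)" "window r f \<noteq> []" "hd (window r f) = v0" "last (window r f) = v0"
    "set (window r f) \<subseteq> W" "walk_loop v0 (window r f) = (\<lambda>i. f (i - int r))"
proof -
  have "adj_eq R (f (int k - int r)) (f (int (Suc k) - int r))" for k
    using assms(1) unfolding based_def zmap_def by (metis add_diff_eq add.commute int_ops(4))
  then show "walk R (window r f)"
    unfolding successively_conv_nth window_def by (auto simp del: upt_Suc)
  show "walk_loop v0 (window r f) = (\<lambda>i. f (i - int r))"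
    using assms(2) by (auto simp: walk_loop_def window_def fun_eq_iff simp del: upt_Suc)
  have "window r f ! 0 = f (- int r)" "window r f ! (2 * r) = f (int r)"
    unfolding window_def by (simp_all del: upt_Suc)
  moreover have "window r f \<noteq> []" "length (window r f) = 2 * r + 1"
    by (simp_all add: window_def)
  ultimately show "window r f \<noteq> []" "hd (window r f) = v0" "last (window r f) = v0"
    using assms(2) by (simp_all add: hd_conv_nth last_conv_nth)
  show "set (window r f) \<subseteq> W"
    using assms(1) by (auto simp: window_def based_def zmap_def)
qed

lemma based_homotopic_window:
  assumes "symp R" "based W R v0 f" "\<forall>i. \<bar>i\<bar> \<ge> int r \<longrightarrow> f i = v0"
  shows "based_homotopic W R v0 f (walk_loop v0 (window r f))"
  unfolding window_props(6)[OF assms(2,3)]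
  by (rule based_homotopic_sym[OF assms(1) based_homotopic_shift[OF assms(2)]])

section \<open>Chains of dimension at most two\<close>

definition point :: "'a \<Rightarrow> bool list \<Rightarrow> 'a" where
  "point x = restrict (\<lambda>_. x) (cube_pts 0)"

definition edge :: "'a \<Rightarrow> 'a \<Rightarrow> bool list \<Rightarrow> 'a" where
  "edge u v = restrict (\<lambda>p. if hd p then v else u) (cube_pts 1)"

lemma cube_pts_0: "cube_pts 0 = {[]}"
  by (auto simp: cube_pts_def)

lemma cube_pts_1: "cube_pts (Suc 0) = {[False], [True]}"
  by (auto simp: cube_pts_def length_Suc_conv)

lemma cube_pts_2: "cube_pts 2 = {[False, False], [False, True], [True, False], [True, True]}"
  by (auto simp: cube_pts_def numeral_2_eq_2 length_Suc_conv)

lemma point_Nil [simp]: "point x [] = x"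
  by (simp add: point_def cube_pts_0)

lemma point_eq_iff [simp]: "point x = point y \<longleftrightarrow> x = y"
  by (metis point_Nil)

lemma edge_apply [simp]: "edge u v [False] = u" "edge u v [True] = v"
  by (simp_all add: edge_def cube_pts_1)

lemma edge_eq_iff [simp]: "edge u v = edge x y \<longleftrightarrow> u = x \<and> v = y"
  by (metis edge_apply)

lemma edge_collapse: "f \<in> extensional (cube_pts 1) \<Longrightarrow> edge (f [False]) (f [True]) = f"
  by (auto simp: edge_def fun_eq_iff extensional_def cube_pts_1)

lemma face_1: "face 1 1 b f = point (f [b])"
  by (auto simp: face_def point_def cube_pts_0 fun_eq_iff)

lemma face_2_1: "face 2 1 b f = edge (f [b, False]) (f [b, True])"
  by (auto simp: face_def edge_def cube_pts_1 fun_eq_iff)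

lemma face_2_2: "face 2 2 b f = edge (f [False, b]) (f [True, b])"
  by (auto simp: face_def edge_def cube_pts_1 fun_eq_iff)

lemma degenerate_1: "degenerate 1 f \<longleftrightarrow> f [False] = f [True]"
  using face_1[of _ f] by (auto simp: degenerate_def)

lemma atLeastAtMost_1_2: "{1..2::nat} = {1, 2}"
  by auto

lemma degenerate_2: "degenerate 2 f \<longleftrightarrow>
    f [False, False] = f [True, False] \<and> f [False, True] = f [True, True] \<or>
    f [False, False] = f [False, True] \<and> f [True, False] = f [True, True]"
  unfolding degenerate_def atLeastAtMost_1_2 by (auto simp: face_2_1[simplified] face_2_2)

lemma cube_bd_1: "cube_bd 1 f = frag_of (point (f [True])) - frag_of (point (f [False]))"
  using face_1[of _ f] by (simp add: cube_bd_def)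

text \<open>The boundary of a square compares its two paths from \<open>[False, False]\<close> to
  \<open>[True, True]\<close>, just as a homotopy across a square does.\<close>

lemma cube_bd_2: "cube_bd 2 f =
    frag_of (edge (f [False, False]) (f [True, False])) + frag_of (edge (f [True, False]) (f [True,
      True]))
  - frag_of (edge (f [False, False]) (f [False, True])) - frag_of (edge (f [False, True]) (f [True,
    True]))"
  unfolding cube_bd_def atLeastAtMost_1_2 by (simp add: face_2_1[simplified] face_2_2)

lemma bdL_simps:
  "bdL n 0 = 0" "bdL n (frag_of f) = cube_bd n f" "bdL n (a + b) = bdL n a + bdL n b"
  "bdL n (a - b) = bdL n a - bdL n b" "bdL n (- a) = - bdL n a"
  by (simp_all add: bdL_def frag_extend_add frag_extend_diff frag_extend_minus)

locale simple_graph =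
  fixes V :: "'a set" and E :: "'a \<Rightarrow> 'a \<Rightarrow> bool"
  assumes sgraph: "sgraph V E"
begin

lemma symE: "symp E"
  using sgraph by (auto simp: sgraph_def symp_def)

lemma E_in_V: "E u v \<Longrightarrow> u \<in> V" "E u v \<Longrightarrow> v \<in> V"
  using sgraph by (auto simp: sgraph_def)

lemma not_E_refl: "\<not> E u u"
  using sgraph by (auto simp: sgraph_def)

lemma adj_eq_in_V: "adj_eq E u v \<Longrightarrow> u \<in> V \<longleftrightarrow> v \<in> V"
  by (auto simp: adj_eq_def E_in_V)

lemma edge_in_cubes: "u \<in> V \<Longrightarrow> adj_eq E u v \<Longrightarrow> edge u v \<in> cubes V E 1"
  using adj_eq_in_V[of u v] adj_eq_sym[OF symE, of u v]
  by (auto simp: cubes_def cube_map_def cube_pts_1 edge_def)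

lemma cubes_1E:
  assumes "f \<in> cubes V E 1"
  obtains u v where "f = edge u v" "u \<in> V" "v \<in> V" "adj_eq E u v"
proof
  show "f = edge (f [False]) (f [True])"
    using assms edge_collapse[of f] by (simp add: cubes_def cube_map_def)
  have "cube_adj_eq [False] [True]"
    by (simp add: cube_adj_eq_def) (metis (lifting) card_mono card_lessThan finite_lessThan lessThan_iff
      mem_Collect_eq subsetI less_Suc0 One_nat_def)
  then show "f [False] \<in> V" "f [True] \<in> V" "adj_eq E (f [False]) (f [True])"
    using assms by (auto simp: cubes_def cube_map_def cube_pts_1)
qed

lemma cube_adj_eq_2: "cube_adj_eq [a, b] [c, d] \<longleftrightarrow> a = c \<or> b = d"
proof -
  have "{i. i < length [a, b] \<and> [a, b] ! i \<noteq> [c, d] ! i} =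
      (if a = c then {} else {0}) \<union> (if b = d then {} else {1})"
    by (auto simp: less_Suc_eq nth_Cons')
  then show ?thesis by (simp add: cube_adj_eq_def)
qed

lemma square_in_cubes:
  assumes "a \<in> V" "adj_eq E a b" "adj_eq E a c" "adj_eq E b d" "adj_eq E c d"
  obtains f where "f \<in> cubes V E 2" "f [False, False] = a" "f [False, True] = b"
    "f [True, False] = c" "f [True, True] = d"
proof
  define f where "f = restrict (\<lambda>p. if p ! 0 then if p ! 1 then d else c else if p ! 1 then b else a)
    (cube_pts 2)"
  show "f \<in> cubes V E 2"
    using assms adj_eq_in_V[OF assms(2)] adj_eq_in_V[OF assms(3)] adj_eq_in_V[OF assms(4)]
    using adj_eq_sym[OF symE assms(2)] adj_eq_sym[OF symE assms(3)] adj_eq_sym[OF symE assms(4)]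
      adj_eq_sym[OF symE assms(5)]
    by (auto simp: cubes_def cube_map_def f_def cube_pts_2 cube_adj_eq_2)
  show "f [False, False] = a" "f [False, True] = b" "f [True, False] = c" "f [True, True] = d"
    by (simp_all add: f_def cube_pts_2)
qed

lemma cubes_2D:
  assumes "f \<in> cubes V E 2"
  shows "f [False, False] \<in> V" "f [False, True] \<in> V" "f [True, False] \<in> V" "f [True, True] \<in> V"
    "adj_eq E (f [False, False]) (f [False, True])" "adj_eq E (f [False, False]) (f [True, False])"
    "adj_eq E (f [False, True]) (f [True, True])" "adj_eq E (f [True, False]) (f [True, True])"
  using assms by (auto simp: cubes_def cube_map_def cube_pts_2 cube_adj_eq_2)

abbreviation "L n \<equiv> Lgrp V E n"
abbreviation "D n \<equiv> Dgrp V E n"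

lemma carrier_L: "c \<in> carrier (L n) \<longleftrightarrow> Poly_Mapping.keys c \<subseteq> cubes V E n"
  by (simp add: Lgrp_def)

lemma L_simps [simp]: "\<one>\<^bsub>L n\<^esub> = 0" "a \<otimes>\<^bsub>L n\<^esub> b = a + b"
  by (simp_all add: Lgrp_def)

lemma comm_group_L: "comm_group (L n)"
  by (simp add: Lgrp_def abelian_free_Abelian_group)

lemma group_L: "group (L n)"
  by (simp add: Lgrp_def)

lemma L_closed:
  "0 \<in> carrier (L n)" "a \<in> carrier (L n) \<Longrightarrow> b \<in> carrier (L n) \<Longrightarrow> a + b \<in> carrier (L n)"
  "a \<in> carrier (L n) \<Longrightarrow> - a \<in> carrier (L n)"
  "a \<in> carrier (L n) \<Longrightarrow> b \<in> carrier (L n) \<Longrightarrow> a - b \<in> carrier (L n)"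
  "frag_of f \<in> carrier (L n) \<longleftrightarrow> f \<in> cubes V E n"
  using keys_add[of a b] keys_diff[of a b] by (auto simp: carrier_L)

lemma inv_L: "a \<in> carrier (L n) \<Longrightarrow> inv\<^bsub>L n\<^esub> a = - a"
  by (simp add: Lgrp_def)

lemma subgroup_D: "subgroup (D n) (L n)"
  unfolding Dgrp_def by (rule group.generate_is_subgroup[OF group_L]) (auto simp: L_closed)

lemma normal_D: "D n \<lhd> L n"
  by (rule comm_group.subgroup_imp_normal[OF comm_group_L subgroup_D])

lemma D_closed:
  "0 \<in> D n" "a \<in> D n \<Longrightarrow> b \<in> D n \<Longrightarrow> a + b \<in> D n" "a \<in> D n \<Longrightarrow> - a \<in> D n"
  "a \<in> D n \<Longrightarrow> b \<in> D n \<Longrightarrow> a - b \<in> D n"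
  "f \<in> cubes V E n \<Longrightarrow> degenerate n f \<Longrightarrow> frag_of f \<in> D n"
proof -
  show "0 \<in> D n" using subgroup.one_closed[OF subgroup_D] by simp
  show add: "a + b \<in> D n" if "a \<in> D n" "b \<in> D n" for a b
    using subgroup.m_closed[OF subgroup_D that] by simp
  show neg: "- a \<in> D n" if "a \<in> D n" for a
    using subgroup.m_inv_closed[OF subgroup_D that] subgroup.mem_carrier[OF subgroup_D that]
      by (simp add: inv_L)
  show "a - b \<in> D n" if "a \<in> D n" "b \<in> D n"
    using add[OF that(1) neg[OF that(2)]] by simp
  show "frag_of f \<in> D n" if "f \<in> cubes V E n" "degenerate n f"
    using that unfolding Dgrp_def by (intro generate.incl) auto
qed

lemma D_induct [consumes 1, case_names gen zero minus add]:
  assumes "c \<in> D n"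
    and gen: "\<And>f. f \<in> cubes V E n \<Longrightarrow> degenerate n f \<Longrightarrow> P (frag_of f)"
    and "P 0" and minus: "\<And>a. P a \<Longrightarrow> P (- a)" and "\<And>a b. P a \<Longrightarrow> P b \<Longrightarrow> P (a + b)"
  shows "P c"
  using assms(1) unfolding Dgrp_def
proof (induction rule: generate.induct)
  case (inv h)
  then obtain f where "h = frag_of f" "f \<in> cubes V E n" "degenerate n f" by auto
  then show ?case using minus[OF gen] by (simp add: inv_L L_closed)
qed (use assms in auto)

text \<open>The range \<open>{1..0}\<close> is empty, so no 0-cube is degenerate. A coset in
  dimension 0 therefore determines its chain, and the kernel of \<open>bdC\<close> comes from chains
  whose boundary is literally 0.\<close>

lemma D_0: "D 0 = {0}"
  using D_induct[of _ 0 "\<lambda>c. c = 0"] D_closed(1)[of 0] by (auto simp: degenerate_def)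

lemma bdL_2_in_L:
  assumes "c \<in> carrier (L 2)" shows "bdL 2 c \<in> carrier (L 1)"
  using assms[unfolded carrier_L]
proof (induction rule: frag_induction)
  case (one f)
  note f = cubes_2D[OF one]
  show ?case unfolding bdL_simps cube_bd_2
    by (intro L_closed(2,4) L_closed(5)[THEN iffD2] edge_in_cubes f)
qed (auto simp: bdL_simps L_closed)

lemma bdL_1_bdL_2:
  assumes "c \<in> carrier (L 2)" shows "bdL 1 (bdL 2 c) = 0"
  using assms[unfolded carrier_L]
  by (induction rule: frag_induction) (auto simp: bdL_simps cube_bd_1[simplified] cube_bd_2)

lemma bdL_1_D: "d \<in> D 1 \<Longrightarrow> bdL 1 d = 0"
  by (induction rule: D_induct) (auto simp: bdL_simps cube_bd_1[simplified] degenerate_1[simplified])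

lemma degenerate_edge_in_D: "u \<in> V \<Longrightarrow> frag_of (edge u u) \<in> D 1"
  by (intro D_closed edge_in_cubes) (auto simp: degenerate_1[simplified])

text \<open>In a degenerate square one pair of opposite sides coincides and cancels, and the other
  two sides are constant.\<close>

lemma bdL_2_D: "d \<in> D 2 \<Longrightarrow> bdL 2 d \<in> D 1"
proof (induction rule: D_induct)
  case (gen f)
  note f = cubes_2D[OF gen(1)]
  show ?case
    using gen(2) D_closed(4)[OF degenerate_edge_in_D degenerate_edge_in_D, OF f(1) f(2)]
      D_closed(4)[OF degenerate_edge_in_D degenerate_edge_in_D, OF f(3) f(1)]
      D_closed(4)[OF degenerate_edge_in_D degenerate_edge_in_D, OF f(1) f(3)]
      D_closed(4)[OF degenerate_edge_in_D degenerate_edge_in_D, OF f(2) f(1)]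
    by (auto simp: degenerate_2 bdL_simps cube_bd_2)
qed (auto simp: bdL_simps D_closed)

section \<open>The first homology group as cycles modulo null-homologous chains\<close>

definition cycles :: "((bool list \<Rightarrow> 'a) \<Rightarrow>\<^sub>0 int) set" where
  "cycles = {c \<in> carrier (L 1). bdL 1 c = 0}"

text \<open>The preimage in \<open>L 1\<close> of the boundaries in \<open>Cgrp V E 1\<close>. It
  allows homology to be computed with plain chains in place of cosets.\<close>

definition nullhom :: "((bool list \<Rightarrow> 'a) \<Rightarrow>\<^sub>0 int) set" where
  "nullhom = {d + bdL 2 s | d s. d \<in> D 1 \<and> s \<in> carrier (L 2)}"

lemma cycles_closed:
  "0 \<in> cycles" "a \<in> cycles \<Longrightarrow> b \<in> cycles \<Longrightarrow> a + b \<in> cycles" "a \<in> cycles \<Longrightarrow> - a \<in> cycles"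
  by (auto simp: cycles_def bdL_simps L_closed)

lemma nullhom_closed:
  "0 \<in> nullhom" "a \<in> nullhom \<Longrightarrow> b \<in> nullhom \<Longrightarrow> a + b \<in> nullhom"
  "a \<in> nullhom \<Longrightarrow> - a \<in> nullhom" "a \<in> nullhom \<Longrightarrow> b \<in> nullhom \<Longrightarrow> a - b \<in> nullhom"
proof -
  show "0 \<in> nullhom"
    unfolding nullhom_def using D_closed(1)[of 1] L_closed(1)[of 2] bdL_simps(1)[of 2] by force
  show add: "a + b \<in> nullhom" if "a \<in> nullhom" "b \<in> nullhom" for a b
  proof -
    from that obtain d s d' s' where "a = d + bdL 2 s" "d \<in> D 1" "s \<in> carrier (L 2)"
      "b = d' + bdL 2 s'" "d' \<in> D 1" "s' \<in> carrier (L 2)" by (auto simp: nullhom_def)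
    then have "a + b = (d + d') + bdL 2 (s + s')" "d + d' \<in> D 1" "s + s' \<in> carrier (L 2)"
      using D_closed L_closed by (auto simp: bdL_simps)
    then show ?thesis unfolding nullhom_def by blast
  qed
  show neg: "- a \<in> nullhom" if "a \<in> nullhom" for a
  proof -
    from that obtain d s where "a = d + bdL 2 s" "d \<in> D 1" "s \<in> carrier (L 2)"
      by (auto simp: nullhom_def)
    then have "- a = - d + bdL 2 (- s)" "- d \<in> D 1" "- s \<in> carrier (L 2)"
      using D_closed L_closed by (auto simp: bdL_simps)
    then show ?thesis unfolding nullhom_def by blast
  qed
  show "a - b \<in> nullhom" if "a \<in> nullhom" "b \<in> nullhom"
    using add[OF that(1) neg[OF that(2)]] by simp
qed

lemma D_in_nullhom: "d \<in> D 1 \<Longrightarrow> d \<in> nullhom"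
  unfolding nullhom_def using L_closed(1)[of 2] bdL_simps(1)[of 2] by force

lemma bdL_2_in_nullhom: "s \<in> carrier (L 2) \<Longrightarrow> bdL 2 s \<in> nullhom"
  unfolding nullhom_def using D_closed(1)[of 1] by force

definition coset :: "nat \<Rightarrow> ((bool list \<Rightarrow> 'a) \<Rightarrow>\<^sub>0 int) \<Rightarrow> ((bool list \<Rightarrow> 'a) \<Rightarrow>\<^sub>0 int) set" where
  "coset n c = D n #>\<^bsub>L n\<^esub> c"

lemma coset_eq: "coset n c = {d + c | d. d \<in> D n}"
  by (auto simp: coset_def r_coset_def)

lemma coset_eq_iff: "coset n a = coset n b \<longleftrightarrow> a - b \<in> D n"
proof
  assume "coset n a = coset n b"
  moreover have "a \<in> coset n a" using D_closed(1)[of n] by (force simp: coset_eq)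
  ultimately show "a - b \<in> D n" by (auto simp: coset_eq)
next
  assume ab: "a - b \<in> D n"
  have "d + a = (d + (a - b)) + b" "d + b = (d - (a - b)) + a" for d by simp_all
  then show "coset n a = coset n b"
    using D_closed(2,4)[OF _ ab] unfolding coset_eq by blast
qed

lemma carrier_C: "carrier (Cgrp V E n) = coset n ` carrier (L n)"
  by (auto simp: Cgrp_def FactGroup_def RCOSETS_def coset_def)

lemma one_C: "\<one>\<^bsub>Cgrp V E n\<^esub> = coset n 0"
  by (simp add: Cgrp_def FactGroup_def coset_eq)

lemma coset_mult: "coset n a \<otimes>\<^bsub>Cgrp V E n\<^esub> coset n b = coset n (a + b)"
proof -
  have "{d + a | d. d \<in> D n} <#>\<^bsub>L n\<^esub> {d + b | d. d \<in> D n} = {d + (a + b) | d. d \<in> D n}" (is "?A = ?B")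
  proof
    show "?A \<subseteq> ?B"
    proof
      fix x assume "x \<in> ?A"
      then obtain d d' where "x = (d + a) + (d' + b)" "d \<in> D n" "d' \<in> D n"
        by (auto simp: set_mult_def)
      then have "x = (d + d') + (a + b)" "d + d' \<in> D n" by (auto simp: D_closed algebra_simps)
      then show "x \<in> ?B" by blast
    qed
    show "?B \<subseteq> ?A"
    proof
      fix x assume "x \<in> ?B"
      then obtain d where "x = (d + a) + (0 + b)" "d \<in> D n" by (auto simp: algebra_simps)
      then show "x \<in> ?A" unfolding set_mult_def using D_closed(1)[of n] by force
    qed
  qed
  then show ?thesis by (simp add: Cgrp_def FactGroup_def coset_eq)
qed

lemma group_C: "group (Cgrp V E n)"
  unfolding Cgrp_def by (rule normal.factorgroup_is_group[OF normal_D])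

lemma coset_inv: "a \<in> carrier (L n) \<Longrightarrow> inv\<^bsub>Cgrp V E n\<^esub> coset n a = coset n (- a)"
  by (rule group.inv_equality[OF group_C]) (auto simp: coset_mult one_C carrier_C L_closed)

lemma some_in_coset: "\<exists>d\<in>D n. (SOME c. c \<in> coset n a) = d + a"
proof -
  have "a \<in> coset n a" using D_closed(1)[of n] by (force simp: coset_eq)
  then have "(SOME c. c \<in> coset n a) \<in> coset n a" by (rule someI)
  then show ?thesis by (auto simp: coset_eq)
qed

lemma bdC_1: "bdC V E 1 (coset 1 c) = coset 0 (bdL 1 c)"
  using some_in_coset[of 1 c] by (auto simp: bdC_def bdL_simps bdL_1_D[simplified] coset_def)

text \<open>\<open>bdC\<close> takes its representative by \<open>SOME\<close>. Another choice
  changes the boundary by the boundary of a degenerate chain, which is degenerate again.\<close>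

lemma bdC_2: "bdC V E 2 (coset 2 c) = coset 1 (bdL 2 c)"
proof -
  obtain d where d: "d \<in> D 2" "(SOME c'. c' \<in> coset 2 c) = d + c"
    using some_in_coset by blast
  have "coset 1 (bdL 2 (d + c)) = coset 1 (bdL 2 c)"
    using bdL_2_D[OF d(1)] by (simp add: coset_eq_iff bdL_simps)
  then show ?thesis by (simp add: bdC_def d(2)) (simp add: coset_def)
qed

lemma kernel_bdC: "kernel (Cgrp V E 1) (Cgrp V E 0) (bdC V E 1) = coset 1 ` cycles"
proof -
  have "bdC V E 1 (coset 1 c) = \<one>\<^bsub>Cgrp V E 0\<^esub> \<longleftrightarrow> bdL 1 c = 0" for c
    by (simp only: bdC_1 one_C coset_eq_iff D_0) simp
  then show ?thesis by (auto simp: kernel_def carrier_C cycles_def)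
qed

lemma subgroup_cycles: "subgroup (coset 1 ` cycles) (Cgrp V E 1)"
proof (rule group.subgroupI[OF group_C])
  show "coset 1 ` cycles \<subseteq> carrier (Cgrp V E 1)" by (auto simp: carrier_C cycles_def)
  show "coset 1 ` cycles \<noteq> {}" using cycles_closed(1) by blast
qed (auto simp: coset_mult[simplified] coset_inv[simplified] cycles_def L_closed bdL_simps)

text \<open>The element of \<open>H1\<close> given by a cycle: the translate of the boundary
  subgroup by \<open>coset 1 c\<close>, spelled out over representing chains.\<close>

definition hclass :: "((bool list \<Rightarrow> 'a) \<Rightarrow>\<^sub>0 int) \<Rightarrow> ((bool list \<Rightarrow> 'a) \<Rightarrow>\<^sub>0 int) set set" where
  "hclass c = coset 1 ` {bdL 2 s + c | s. s \<in> carrier (L 2)}"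

lemma hclass_eq_iff: "hclass a = hclass b \<longleftrightarrow> a - b \<in> nullhom"
proof
  assume "hclass a = hclass b"
  moreover have "coset 1 a \<in> hclass a"
    unfolding hclass_def using L_closed(1)[of 2] bdL_simps(1)[of 2] by force
  ultimately obtain s where s: "coset 1 a = coset 1 (bdL 2 s + b)" "s \<in> carrier (L 2)"
    by (auto simp: hclass_def)
  then have "a - b = (a - (bdL 2 s + b)) + bdL 2 s" "a - (bdL 2 s + b) \<in> D 1"
    by (simp, simp only: coset_eq_iff)
  then show "a - b \<in> nullhom" using s(2) unfolding nullhom_def by blast
next
  have sub: "hclass a \<subseteq> hclass b" if "a - b \<in> nullhom" for a b
  proof
    fix X assume "X \<in> hclass a"
    then obtain t where t: "X = coset 1 (bdL 2 t + a)" "t \<in> carrier (L 2)" by (auto simp: hclass_def)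
    obtain d s where ds: "a - b = d + bdL 2 s" "d \<in> D 1" "s \<in> carrier (L 2)"
      using \<open>a - b \<in> nullhom\<close> by (auto simp: nullhom_def)
    have "(bdL 2 t + a) - (bdL 2 (t + s) + b) = d"
      using ds(1) by (simp add: bdL_simps algebra_simps)
    then have "X = coset 1 (bdL 2 (t + s) + b)" using t(1) ds(2) by (simp add: coset_eq_iff)
    then show "X \<in> hclass b" unfolding hclass_def using L_closed(2)[OF t(2) ds(3)] by blast
  qed
  assume "a - b \<in> nullhom"
  then show "hclass a = hclass b"
    using sub[of a b] sub[of b a] nullhom_closed(3)[of "a - b"] by simp
qed

lemma carrier_H1: "carrier (H1 V E) = hclass ` cycles"
proof -
  let ?Z = "subgroup_generated (Cgrp V E 1) (coset 1 ` cycles)"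
  have "(bdC V E 2 ` carrier (Cgrp V E 2)) #>\<^bsub>?Z\<^esub> coset 1 c = hclass c" for c
    by (auto simp: r_coset_def hclass_def carrier_C bdC_2 coset_mult[simplified])
  then show ?thesis
    unfolding H1_def FactGroup_def RCOSETS_def kernel_bdC
    by (simp add: subgroup.carrier_subgroup_generated_subgroup[OF subgroup_cycles, simplified]
        UNION_singleton_eq_range image_image)
qed

lemma hclass_mult: "hclass a \<otimes>\<^bsub>H1 V E\<^esub> hclass b = hclass (a + b)"
proof -
  have "hclass a \<otimes>\<^bsub>H1 V E\<^esub> hclass b = {X \<otimes>\<^bsub>Cgrp V E 1\<^esub> Y | X Y. X \<in> hclass a \<and> Y \<in> hclass b}"
    by (auto simp: H1_def FactGroup_def set_mult_def)
  also have "\<dots> = hclass (a + b)" (is "?A = ?B")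
  proof
    show "?A \<subseteq> ?B"
    proof
      fix X assume "X \<in> ?A"
      then obtain s t where "X = coset 1 ((bdL 2 s + a) + (bdL 2 t + b))" "s \<in> carrier (L 2)"
        "t \<in> carrier (L 2)"
        by (auto simp: hclass_def coset_mult[simplified])
      then have "X = coset 1 (bdL 2 (s + t) + (a + b))" "s + t \<in> carrier (L 2)"
        by (auto simp: bdL_simps L_closed algebra_simps)
      then show "X \<in> ?B" unfolding hclass_def by blast
    qed
    show "?B \<subseteq> ?A"
    proof
      fix X assume "X \<in> ?B"
      then obtain s where s: "X = coset 1 (bdL 2 s + (a + b))" "s \<in> carrier (L 2)"
        by (auto simp: hclass_def)
      have "X = coset 1 (bdL 2 s + a) \<otimes>\<^bsub>Cgrp V E 1\<^esub> coset 1 (bdL 2 0 + b)"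
        unfolding coset_mult s(1) by (simp add: bdL_simps add.assoc)
      then show "X \<in> ?A" unfolding hclass_def using s(2) L_closed(1)[of 2] by blast
    qed
  qed
  finally show ?thesis .
qed

end

section \<open>The chain traced out by the moving tokens\<close>

fun walk_sum :: "('v \<Rightarrow> 'v \<Rightarrow> 'c::ab_group_add) \<Rightarrow> 'v list \<Rightarrow> 'c" where
  "walk_sum e (x # y # w) = e x y + walk_sum e (y # w)"
| "walk_sum e _ = 0"

lemma walk_sum_append:
  "p \<noteq> [] \<Longrightarrow> q \<noteq> [] \<Longrightarrow> walk_sum e (p @ q) = walk_sum e p + e (last p) (hd q) + walk_sum e q"
proof (induction p rule: induct_list012)
  case (2 x)
  then show ?case by (cases q) auto
qed auto

lemma walk_sum_nth: "walk_sum e w = (\<Sum>k<length w - 1. e (w ! k) (w ! Suc k))"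
  by (induction w rule: induct_list012) (auto simp: sum.lessThan_Suc_shift simp del: sum.lessThan_Suc)

text \<open>For adjacent distinct monomials both multiset differences are singletons, so the moved
  token is determined. A pause counts as 0 and not as a degenerate edge, so that a based map has a
  finite sum of steps.\<close>

definition token_step :: "'a multiset \<Rightarrow> 'a multiset \<Rightarrow> (bool list \<Rightarrow> 'a) \<Rightarrow>\<^sub>0 int" where
  "token_step M N = (if M = N then 0
     else frag_of (edge (THE u. M - N = {#u#}) (THE v. N - M = {#v#})))"

lemma token_step_refl [simp]: "token_step M M = 0"
  by (simp add: token_step_def)

lemma token_step_move: "u \<noteq> v \<Longrightarrow> token_step (add_mset u g) (add_mset v g) = frag_of (edge u v)"
  by (simp add: token_step_def)

definition loop_chain :: "(int \<Rightarrow> 'a multiset) \<Rightarrow> (bool list \<Rightarrow> 'a) \<Rightarrow>\<^sub>0 int" where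
  "loop_chain f = (\<Sum>i | f i \<noteq> f (i + 1). token_step (f i) (f (i + 1)))"

lemma loop_chain_eq_sum:
  assumes "finite A" "{i. f i \<noteq> f (i + 1)} \<subseteq> A"
  shows "loop_chain f = (\<Sum>i\<in>A. token_step (f i) (f (i + 1)))"
  unfolding loop_chain_def by (rule sum.mono_neutral_left) (use assms in auto)

lemma loop_chain_shift: "loop_chain (\<lambda>i. f (i + c)) = loop_chain f"
  unfolding loop_chain_def
  by (rule sum.reindex_bij_witness[where i = "\<lambda>i. i - c" and j = "\<lambda>i. i + c"])
    (auto simp: algebra_simps)

lemma loop_chain_walk_loop:
  assumes "w \<noteq> []" "hd w = v0" "last w = v0"
  shows "loop_chain (walk_loop v0 w) = walk_sum token_step w"
proof -
  let ?f = "walk_loop v0 w"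
  have 0: "?f i = v0" if "i \<le> 0 \<or> i \<ge> int (length w - 1)" for i
    using assms that by (cases "i = 0 \<or> i = int (length w - 1)")
      (auto simp: walk_loop_def hd_conv_nth last_conv_nth)
  have "{i. ?f i \<noteq> ?f (i + 1)} \<subseteq> int ` {..<length w - 1}"
  proof
    fix i assume i: "i \<in> {i. ?f i \<noteq> ?f (i + 1)}"
    have "i \<ge> 0" using i 0[of i] 0[of "i + 1"] by force
    moreover have "i < int (length w - 1)" using i 0[of i] 0[of "i + 1"] by force
    ultimately show "i \<in> int ` {..<length w - 1}"
      by (metis image_eqI lessThan_iff nonneg_int_cases of_nat_less_iff)
  qed
  then have "loop_chain ?f = (\<Sum>i\<in>int ` {..<length w - 1}. token_step (?f i) (?f (i + 1)))"
    by (intro loop_chain_eq_sum) auto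
  also have "\<dots> = (\<Sum>k<length w - 1. token_step (w ! k) (w ! Suc k))"
    by (subst sum.reindex) (auto intro!: sum.cong simp: walk_loop_def nat_add_distrib)
  finally show ?thesis by (simp add: walk_sum_nth)
qed

lemma loop_chain_window:
  assumes "based W R v0 f" "\<forall>i. \<bar>i\<bar> \<ge> int r \<longrightarrow> f i = v0"
  shows "loop_chain f = walk_sum token_step (window r f)"
  using loop_chain_walk_loop[OF window_props(2,3,4)[OF assms]] loop_chain_shift[of f "- int r"]
  by (simp add: window_props(6)[OF assms])

lemma loop_chain_concat:
  assumes "based W R v0 f" "based W R v0 g"
  shows "loop_chain (path_concat v0 f g) = loop_chain f + loop_chain g"
proof -
  define rf rg where "rf = int (rad v0 f)" and "rg = int (rad v0 g)"
  \<comment> \<open>After the shifts the moves of \<open>f\<close> fall into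
    \<open>{-2 * rf..<0}\<close> and those of \<open>g\<close> into \<open>{0..<2 * rg}\<close>;
    \<open>s\<close> bounds both.\<close>
  define s where "s = 2 * rf + 2 * rg"
  have f: "f i = v0" if "\<bar>i\<bar> \<ge> rf" for i using rad_spec[OF assms(1)] that by (simp add: rf_def)
  have g: "g i = v0" if "\<bar>i\<bar> \<ge> rg" for i using rad_spec[OF assms(2)] that by (simp add: rg_def)
  have nonneg: "rf \<ge> 0" "rg \<ge> 0" by (auto simp: rf_def rg_def)
  let ?p = "path_concat v0 f g"
  have p1: "?p i = f (i + rf)" if "i \<le> 0" for i using that by (simp add: path_concat_def rf_def)
  have p2: "?p i = g (i - rg)" if "i \<ge> 0" for i
    using that f[of rf] g[of "- rg"] nonneg by (cases "i = 0") (auto simp: path_concat_def rf_def rg_def)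
  have F: "{i. f (i + rf) \<noteq> f (i + 1 + rf)} \<subseteq> {-s..<0}"
  proof
    fix i assume i: "i \<in> {i. f (i + rf) \<noteq> f (i + 1 + rf)}"
    have "i < 0" using i f[of "i + rf"] f[of "i + 1 + rf"] nonneg by force
    moreover have "i \<ge> - s" using i f[of "i + rf"] f[of "i + 1 + rf"] nonneg by (force simp: s_def)
    ultimately show "i \<in> {-s..<0}" by simp
  qed
  have G: "{i. g (i - rg) \<noteq> g (i + 1 - rg)} \<subseteq> {0..<s}"
  proof
    fix i assume i: "i \<in> {i. g (i - rg) \<noteq> g (i + 1 - rg)}"
    have "i \<ge> 0" using i g[of "i - rg"] g[of "i + 1 - rg"] nonneg by force
    moreover have "i < s" using i g[of "i - rg"] g[of "i + 1 - rg"] nonneg by (force simp: s_def)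
    ultimately show "i \<in> {0..<s}" by simp
  qed
  have "{i. ?p i \<noteq> ?p (i + 1)} \<subseteq> {-s..<0} \<union> {0..<s}"
  proof
    fix i assume i: "i \<in> {i. ?p i \<noteq> ?p (i + 1)}"
    show "i \<in> {-s..<0} \<union> {0..<s}"
    proof (cases "i < 0")
      case True
      then show ?thesis using i F p1[of i] p1[of "i + 1"] by auto
    next
      case False
      then show ?thesis using i G p2[of i] p2[of "i + 1"] by auto
    qed
  qed
  then have "loop_chain ?p = (\<Sum>i\<in>{-s..<0} \<union> {0..<s}. token_step (?p i) (?p (i + 1)))"
    by (intro loop_chain_eq_sum) auto
  also have "\<dots> = (\<Sum>i\<in>{-s..<0}. token_step (?p i) (?p (i + 1))) + (\<Sum>i\<in>{0..<s}. token_step (?p i) (?p (i +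
    1)))"
    by (intro sum.union_disjoint) auto
  also have "(\<Sum>i\<in>{-s..<0}. token_step (?p i) (?p (i + 1))) =
    (\<Sum>i\<in>{-s..<0}. token_step (f (i + rf)) (f (i + 1 + rf)))"
    by (rule sum.cong) (auto simp: p1)
  also have "\<dots> = loop_chain f"
    using loop_chain_eq_sum[OF _ F] loop_chain_shift[of f rf] by simp
  also have "(\<Sum>i\<in>{0..<s}. token_step (?p i) (?p (i + 1))) =
    (\<Sum>i\<in>{0..<s}. token_step (g (i - rg)) (g (i + 1 - rg)))"
    by (rule sum.cong) (auto simp: p2)
  also have "\<dots> = loop_chain g"
    using loop_chain_eq_sum[OF _ G] loop_chain_shift[of g "- rg"] by simp
  finally show ?thesis .
qed

section \<open>Closed walks of length at most four bound\<close>

context simple_graph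
begin

abbreviation ed :: "'a \<Rightarrow> 'a \<Rightarrow> (bool list \<Rightarrow> 'a) \<Rightarrow>\<^sub>0 int" where
  "ed u v \<equiv> frag_of (edge u v)"

lemma nullhom_trans: "a - b \<in> nullhom \<Longrightarrow> b - c \<in> nullhom \<Longrightarrow> a - c \<in> nullhom"
  using nullhom_closed(2)[of "a - b" "b - c"] by simp

lemma nullhom_add_cong: "a - b \<in> nullhom \<Longrightarrow> c - d \<in> nullhom \<Longrightarrow> (a + c) - (b + d) \<in> nullhom"
  using nullhom_closed(2)[of "a - b" "c - d"] by (simp add: algebra_simps)

lemma nullhom_cong: "a - b \<in> nullhom \<Longrightarrow> a \<in> nullhom \<longleftrightarrow> b \<in> nullhom"
  using nullhom_closed(2)[of "a - b" b] nullhom_closed(4)[of a "a - b"] by auto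

lemma nullhom_ed_refl: "u \<in> V \<Longrightarrow> ed u u \<in> nullhom"
  by (intro D_in_nullhom degenerate_edge_in_D)

lemma nullhom_square:
  assumes "a \<in> V" "adj_eq E a b" "adj_eq E b c" "adj_eq E a d" "adj_eq E d c"
  shows "ed a b + ed b c - ed a d - ed d c \<in> nullhom"
proof -
  obtain f where "f \<in> cubes V E 2" "f [False, False] = a" "f [False, True] = d"
    "f [True, False] = b" "f [True, True] = c"
    using square_in_cubes[OF assms(1,4,2,5,3)] by blast
  then show ?thesis
    using bdL_2_in_nullhom[of "frag_of f"] by (simp add: L_closed bdL_simps cube_bd_2)
qed

text \<open>An edge and its reverse are distinct generators. Their sum bounds only via the square
  with one path \<open>u\<close>, \<open>v\<close>, \<open>u\<close> and the other resting at
  \<open>u\<close>, and up to two degenerate edges.\<close>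

lemma nullhom_ed_sym:
  assumes "u \<in> V" "adj_eq E u v" shows "ed u v + ed v u \<in> nullhom"
proof -
  have "ed u v + ed v u - ed u u - ed u u \<in> nullhom"
    using assms adj_eq_sym[OF symE assms(2)] by (intro nullhom_square) auto
  from nullhom_closed(2)[OF nullhom_closed(2)[OF this nullhom_ed_refl[OF assms(1)]]
    nullhom_ed_refl[OF assms(1)]]
  show ?thesis by simp
qed

text \<open>Reversing the last two sides turns the cycle into the two paths of a square from
  \<open>a\<close> to \<open>c\<close>; \<open>nullhom_ed_sym\<close> pays for the
  reversals.\<close>

lemma nullhom_cycle4:
  assumes "a \<in> V" "adj_eq E a b" "adj_eq E b c" "adj_eq E c d" "adj_eq E d a"
  shows "ed a b + ed b c + ed c d + ed d a \<in> nullhom"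
proof -
  have V: "d \<in> V" "c \<in> V" using assms adj_eq_in_V by blast+
  have ad: "adj_eq E a d" and dc: "adj_eq E d c" using assms adj_eq_sym[OF symE] by blast+
  show ?thesis
    using nullhom_closed(2)[OF nullhom_square[OF assms(1-3) ad dc]
        nullhom_closed(2)[OF nullhom_ed_sym[OF V(1) assms(5)] nullhom_ed_sym[OF V(2) assms(4)]]]
    by (simp add: algebra_simps)
qed

lemma nullhom_cycle3:
  assumes "a \<in> V" "adj_eq E a b" "adj_eq E b c" "adj_eq E c a"
  shows "ed a b + ed b c + ed c a \<in> nullhom"
  using nullhom_closed(4)[OF nullhom_cycle4[OF assms adj_eq_refl] nullhom_ed_refl[OF assms(1)]] by simp

text \<open>A family of at most four edges whose sources and targets agree as multisets splits into
  closed walks of length at most four, each of which bounds.\<close>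

lemma nullhom_balanced2:
  assumes "{#v1, v2#} = {#u1, u2#}" "u1 \<in> V" "u2 \<in> V" "adj_eq E u1 v1" "adj_eq E u2 v2"
  shows "ed u1 v1 + ed u2 v2 \<in> nullhom"
proof -
  from assms(1) consider "v1 = u1" "v2 = u2" | "v1 = u2" "v2 = u1"
    by (auto simp: add_eq_conv_ex)
  then show ?thesis
    by cases (use assms in \<open>auto intro: nullhom_closed nullhom_ed_refl nullhom_ed_sym\<close>)
qed

lemma nullhom_balanced3:
  assumes eq: "{#v1, v2, v3#} = {#u1, u2, u3#}" and "u1 \<in> V" "u2 \<in> V" "u3 \<in> V"
    "adj_eq E u1 v1" "adj_eq E u2 v2" "adj_eq E u3 v3"
  shows "ed u1 v1 + ed u2 v2 + ed u3 v3 \<in> nullhom"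
proof -
  \<comment> \<open>Follow the first edge: if it does not end at its own source, relabelling makes
    its end the source of the second edge.\<close>
  have aux: "ed u1 v1 + ed u2 v2 + ed u3 v3 \<in> nullhom"
    if "v1 = u2" "{#v2, v3#} = {#u1, u3#}" "u1 \<in> V" "u2 \<in> V" "u3 \<in> V"
      "adj_eq E u1 v1" "adj_eq E u2 v2" "adj_eq E u3 v3" for u1 u2 u3 v1 v2 v3
  proof -
    from that(2) consider "v2 = u1" "v3 = u3" | "v2 = u3" "v3 = u1"
      by (auto simp: add_eq_conv_ex)
    then show ?thesis
      by cases (use that in \<open>auto intro: nullhom_closed nullhom_ed_refl nullhom_ed_sym nullhom_cycle3\<close>)
  qed
  have "v1 \<in># {#u1, u2, u3#}" using eq by (metis union_single_eq_member add_mset_add_single)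
  then consider "v1 = u1" | "v1 = u2" | "v1 = u3" by auto
  then show ?thesis
  proof cases
    case 1
    then show ?thesis
      using nullhom_closed(2)[OF nullhom_ed_refl nullhom_balanced2[of v2 v3 u2 u3]] assms
      by (simp add: add.assoc)
  next
    case 2
    then show ?thesis using assms by (intro aux) (auto simp: add_mset_commute)
  next
    case 3
    then have "ed u1 v1 + ed u3 v3 + ed u2 v2 \<in> nullhom"
      using assms by (intro aux) (auto simp: add_mset_commute)
    then show ?thesis by (simp add: algebra_simps)
  qed
qed

lemma nullhom_balanced4:
  assumes eq: "{#v1, v2, v3, v4#} = {#u1, u2, u3, u4#}" and "u1 \<in> V" "u2 \<in> V" "u3 \<in> V" "u4 \<in> V"
    "adj_eq E u1 v1" "adj_eq E u2 v2" "adj_eq E u3 v3" "adj_eq E u4 v4"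
  shows "ed u1 v1 + ed u2 v2 + ed u3 v3 + ed u4 v4 \<in> nullhom"
proof -
  \<comment> \<open>\<open>aux1\<close> treats a walk that has already run through two edges,
    \<open>aux\<close> one that has run through one; the remaining cases are relabellings.\<close>
  have aux1: "ed u1 v1 + ed u2 v2 + ed u3 v3 + ed u4 v4 \<in> nullhom"
    if "v1 = u2" "v2 = u3" "{#v3, v4#} = {#u1, u4#}" "u1 \<in> V" "u2 \<in> V" "u3 \<in> V" "u4 \<in> V"
      "adj_eq E u1 v1" "adj_eq E u2 v2" "adj_eq E u3 v3" "adj_eq E u4 v4"
    for u1 u2 u3 u4 v1 v2 v3 v4
  proof -
    from that(3) consider "v3 = u1" "v4 = u4" | "v3 = u4" "v4 = u1"
      by (auto simp: add_eq_conv_ex)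
    then show ?thesis
    proof cases
      case 1
      then show ?thesis
        using that nullhom_closed(2)[OF nullhom_cycle3[of u1 u2 u3] nullhom_ed_refl[of u4]] by simp
    next
      case 2
      then show ?thesis using that by (auto intro!: nullhom_cycle4)
    qed
  qed
  have aux: "ed u1 v1 + ed u2 v2 + ed u3 v3 + ed u4 v4 \<in> nullhom"
    if "v1 = u2" "{#v2, v3, v4#} = {#u1, u3, u4#}" "u1 \<in> V" "u2 \<in> V" "u3 \<in> V" "u4 \<in> V"
      "adj_eq E u1 v1" "adj_eq E u2 v2" "adj_eq E u3 v3" "adj_eq E u4 v4"
    for u1 u2 u3 u4 v1 v2 v3 v4
  proof -
    have "v2 \<in># {#u1, u3, u4#}" using that(2) by (metis union_single_eq_member add_mset_add_single)
    then consider "v2 = u1" | "v2 = u3" | "v2 = u4" by auto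
    then show ?thesis
    proof cases
      case 1
      then have "ed u1 v1 + ed u2 v2 \<in> nullhom" "ed u3 v3 + ed u4 v4 \<in> nullhom"
        using that by (auto intro!: nullhom_ed_sym nullhom_balanced2)
      from nullhom_closed(2)[OF this] show ?thesis by (simp add: add.assoc)
    next
      case 2
      then show ?thesis using that by (intro aux1) (auto simp: add_mset_commute)
    next
      case 3
      then have "ed u1 v1 + ed u2 v2 + ed u4 v4 + ed u3 v3 \<in> nullhom"
        using that by (intro aux1) (auto simp: add_mset_commute)
      then show ?thesis by (simp add: algebra_simps)
    qed
  qed
  have "v1 \<in># {#u1, u2, u3, u4#}" using eq by (metis union_single_eq_member add_mset_add_single)
  then consider "v1 = u1" | "v1 = u2" | "v1 = u3" | "v1 = u4" by auto
  then show ?thesis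
  proof cases
    case 1
    then show ?thesis
      using nullhom_closed(2)[OF nullhom_ed_refl nullhom_balanced3[of v2 v3 v4 u2 u3 u4]] assms
      by (simp add: add.assoc)
  next
    case 2
    then show ?thesis using assms by (intro aux) (auto simp: add_mset_commute)
  next
    case 3
    then have "ed u1 v1 + ed u3 v3 + ed u2 v2 + ed u4 v4 \<in> nullhom"
      using assms by (intro aux) (auto simp: add_mset_commute)
    then show ?thesis by (simp add: algebra_simps)
  next
    case 4
    then have "ed u1 v1 + ed u4 v4 + ed u2 v2 + ed u3 v3 \<in> nullhom"
      using assms by (intro aux) (auto simp: add_mset_commute)
    then show ?thesis by (simp add: algebra_simps)
  qed
qed

section \<open>Squares in the reduced power\<close>

abbreviation adjr :: "'a multiset \<Rightarrow> 'a multiset \<Rightarrow> bool" where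
  "adjr \<equiv> adj_eq (rpow_edge E)"

lemma adjr_add_mset: "adj_eq E u v \<Longrightarrow> adjr (add_mset u g) (add_mset v g)"
  unfolding adj_eq_def rpow_edge_def by (metis add_mset_add_single)

lemma adjr_context: "adjr M N \<Longrightarrow> adjr (add_mset u M) (add_mset u N)"
  unfolding adj_eq_def rpow_edge_def by (metis union_mset_add_mset_left)

text \<open>A pause is read as some token moving along the trivial edge \<open>u u\<close>, so that
  all sides of a square are treated alike. For this a token must exist.\<close>

lemma adjrE:
  assumes "adjr M N" "M \<noteq> {#}" "set_mset M \<subseteq> V"
  obtains u v g where "M = add_mset u g" "N = add_mset v g" "adj_eq E u v" "u \<in> V" "v \<in> V"
proof (cases "M = N")
  case True
  obtain u g where "M = add_mset u g" using assms(2) multiset_cases by blast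
  then show thesis using that[of u g u] True assms(3) by auto
next
  case False
  then obtain u v g where "M = add_mset u g" "N = add_mset v g" "E u v"
    using assms(1) by (auto simp: adj_eq_def rpow_edge_def)
  then show thesis using that[of u g v] E_in_V by (auto simp: adj_eq_def)
qed

lemma symp_rpow: "symp (rpow_edge E)"
  unfolding rpow_edge_def symp_def using sympD[OF symE] by blast

lemma symmetric_graph_rpow: "symmetric_graph (rpow_verts V n) (rpow_edge E)"
  by unfold_locales (auto simp: symp_rpow rpow_edge_def rpow_verts_def E_in_V)

lemma token_step_homologous:
  assumes "u \<in> V" "adj_eq E u v"
  shows "token_step (add_mset u g) (add_mset v g) - ed u v \<in> nullhom"
  using nullhom_ed_refl[OF assms(1)] nullhom_closed(1,3)
  by (cases "u = v") (auto simp: token_step_move)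

lemma token_step_square:
  assumes "adjr M1 M2" "adjr M2 M3" "adjr M3 M4" "adjr M4 M1" "M1 \<in> rpow_verts V n" "n > 0"
  shows "token_step M1 M2 + token_step M2 M3 + token_step M3 M4 + token_step M4 M1 \<in> nullhom"
proof -
  have closed: "N \<in> rpow_verts V n" if "adjr M N" "M \<in> rpow_verts V n" for M N
    using symmetric_graph.R_closed[OF symmetric_graph_rpow] that by (auto simp: adj_eq_def)
  have ne: "M \<noteq> {#}" "set_mset M \<subseteq> V" if "M \<in> rpow_verts V n" for M
    using that assms(6) by (auto simp: rpow_verts_def)
  have M: "M2 \<in> rpow_verts V n" "M3 \<in> rpow_verts V n" "M4 \<in> rpow_verts V n"
    using closed assms by blast+
  obtain u1 v1 g1 where 1: "M1 = add_mset u1 g1" "M2 = add_mset v1 g1" "adj_eq E u1 v1" "u1 \<in> V"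
    using adjrE[OF assms(1)] ne[OF assms(5)] by metis
  obtain u2 v2 g2 where 2: "M2 = add_mset u2 g2" "M3 = add_mset v2 g2" "adj_eq E u2 v2" "u2 \<in> V"
    using adjrE[OF assms(2)] ne[OF M(1)] by metis
  obtain u3 v3 g3 where 3: "M3 = add_mset u3 g3" "M4 = add_mset v3 g3" "adj_eq E u3 v3" "u3 \<in> V"
    using adjrE[OF assms(3)] ne[OF M(2)] by metis
  obtain u4 v4 g4 where 4: "M4 = add_mset u4 g4" "M1 = add_mset v4 g4" "adj_eq E u4 v4" "u4 \<in> V"
    using adjrE[OF assms(4)] ne[OF M(3)] by metis
  \<comment> \<open>The balance of each move is written without subtraction. In the sum of the four,
    the monomials cancel and only the sources and targets remain.\<close>
  have "M1 + {#v1#} = M2 + {#u1#}" "M2 + {#v2#} = M3 + {#u2#}"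
    "M3 + {#v3#} = M4 + {#u3#}" "M4 + {#v4#} = M1 + {#u4#}"
    using 1(1,2) 2(1,2) 3(1,2) 4(1,2) by (metis add_mset_add_single add_mset_commute)+
  then have "(M1 + {#v1#}) + (M2 + {#v2#}) + (M3 + {#v3#}) + (M4 + {#v4#})
      = (M2 + {#u1#}) + (M3 + {#u2#}) + (M4 + {#u3#}) + (M1 + {#u4#})" by argo
  then have "(M1 + M2 + M3 + M4) + {#v1, v2, v3, v4#} = (M1 + M2 + M3 + M4) + {#u1, u2, u3, u4#}"
    by (simp add: ac_simps)
  then have "{#v1, v2, v3, v4#} = {#u1, u2, u3, u4#}" by (simp only: add_left_cancel)
  then have "ed u1 v1 + ed u2 v2 + ed u3 v3 + ed u4 v4 \<in> nullhom"
    by (rule nullhom_balanced4) fact+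
  moreover have ts: "token_step M1 M2 - ed u1 v1 \<in> nullhom" "token_step M2 M3 - ed u2 v2 \<in> nullhom"
    "token_step M3 M4 - ed u3 v3 \<in> nullhom" "token_step M4 M1 - ed u4 v4 \<in> nullhom"
    using token_step_homologous 1 2 3 4 by metis+
  ultimately show ?thesis
    using nullhom_cong[OF nullhom_add_cong[OF nullhom_add_cong[OF nullhom_add_cong[OF ts(1,2)] ts(3)]
      ts(4)]]
    by blast
qed

lemma token_step_sym:
  assumes "adjr M N" "M \<in> rpow_verts V n" "n > 0"
  shows "token_step M N + token_step N M \<in> nullhom"
  using token_step_square[OF assms(1) adj_eq_sym[OF symp_rpow assms(1)]
    adj_eq_refl adj_eq_refl assms(2,3)]
  by simp

section \<open>Homotopy invariance of the traced chain\<close>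

lemma walk_sum_rev:
  assumes "walk (rpow_edge E) p" "set p \<subseteq> rpow_verts V n" "n > 0"
  shows "walk_sum token_step p + walk_sum token_step (rev p) \<in> nullhom"
  using assms
proof (induction p rule: induct_list012)
  case (3 M N p)
  have "walk_sum token_step (rev (M # N # p)) =
      walk_sum token_step (rev (N # p)) + token_step N M"
    using walk_sum_append[of "rev (N # p)" "[M]" token_step] by simp
  then show ?case
    using nullhom_closed(2)[OF token_step_sym[of M N n] "3.IH"(2)] 3 by (simp add: algebra_simps)
qed (auto simp: nullhom_closed)

text \<open>Two parallel walks bound a strip of squares. Neighbouring squares share a rung, so in
  the sum only the two end rungs survive.\<close>

lemma walk_sum_parallel:
  assumes "list_all2 adjr p q" "walk (rpow_edge E) p" "walk (rpow_edge E) q"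
    "set p \<subseteq> rpow_verts V n" "n > 0" "p \<noteq> []"
  shows "walk_sum token_step p + token_step (last p) (last q)
    - token_step (hd p) (hd q) - walk_sum token_step q \<in> nullhom"
  using assms
proof (induction p arbitrary: q rule: induct_list012)
  case (2 M)
  then show ?case by (auto simp: list_all2_Cons1 nullhom_closed)
next
  case (3 M N p)
  then obtain M' N' q' where q: "q = M' # N' # q'" "adjr M M'" "adjr N N'" "list_all2 adjr p q'"
    by (auto simp: list_all2_Cons1)
  have IH: "walk_sum token_step (N # p) + token_step (last (N # p)) (last (N' # q'))
    - token_step N N' - walk_sum token_step (N' # q') \<in> nullhom"
    using "3.IH"(2)[of "N' # q'"] 3 q by auto
  have adj: "adjr M N" "adjr M' N'" and M: "M \<in> rpow_verts V n" using 3 q by auto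
  have verts: "N' \<in> rpow_verts V n" "M' \<in> rpow_verts V n"
    using symmetric_graph.R_closed[OF symmetric_graph_rpow] q(2,3) 3 by (auto simp: adj_eq_def)
  have "token_step M N + token_step N N' + token_step N' M' + token_step M' M \<in> nullhom"
    by (rule token_step_square[OF adj(1) q(3) adj_eq_sym[OF symp_rpow adj(2)]
      adj_eq_sym[OF symp_rpow q(2)] M \<open>n > 0\<close>])
  \<comment> \<open>The square is traversed as a closed walk, with its first rung and its side on
    \<open>q\<close> backwards; \<open>token_step_sym\<close> turns these two around.\<close>
  from nullhom_closed(4)[OF nullhom_closed(2)[OF IH this]
      nullhom_closed(2)[OF token_step_sym[OF q(2) M \<open>n > 0\<close>] token_step_sym[OF adj(2) verts(2) \<open>n > 0\<close>]]]
  show ?case by (simp add: q(1) algebra_simps)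
qed simp

lemma loop_chain_homotopic:
  assumes "based_homotopic (rpow_verts V n) (rpow_edge E) M0 f g" "n > 0"
  shows "loop_chain f - loop_chain g \<in> nullhom"
proof -
  obtain m and h :: "int \<Rightarrow> nat \<Rightarrow> 'a multiset" where h: "\<forall>i. h i 0 = f i" "\<forall>i. h i m = g i"
      "\<forall>j\<le>m. based (rpow_verts V n) (rpow_edge E) M0 (\<lambda>i. h i j)"
      "\<forall>i j. j < m \<longrightarrow> adjr (h i j) (h i (Suc j))"
    using assms(1) unfolding based_homotopic_def by blast
  have "loop_chain (\<lambda>i. h i 0) - loop_chain (\<lambda>i. h i j) \<in> nullhom" if "j \<le> m" for j
    using that
  proof (induction j)
    case (Suc j)
    let ?f = "\<lambda>i. h i j" and ?g = "\<lambda>i. h i (Suc j)"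
    have b: "based (rpow_verts V n) (rpow_edge E) M0 ?f" "based (rpow_verts V n) (rpow_edge E) M0 ?g"
      using h(3) Suc.prems by auto
    \<comment> \<open>A common window makes the rows correspond position by position. Both rows are
      \<open>M0\<close> at its ends, so the end rungs of the strip contribute 0.\<close>
    define r where "r = max (rad M0 ?f) (rad M0 ?g)"
    have r: "\<forall>i. \<bar>i\<bar> \<ge> int r \<longrightarrow> ?f i = M0" "\<forall>i. \<bar>i\<bar> \<ge> int r \<longrightarrow> ?g i = M0"
      using rad_spec[OF b(1)] rad_spec[OF b(2)] by (auto simp: r_def)
    have "list_all2 adjr (window r ?f) (window r ?g)"
      using h(4) Suc.prems by (auto simp: window_def list_all2_conv_all_nth simp del: upt_Suc)
    from walk_sum_parallel[OF this window_props(1)[OF b(1) r(1)] window_props(1)[OF b(2) r(2)]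
        window_props(5)[OF b(1) r(1)] assms(2) window_props(2)[OF b(1) r(1)]]
    have "loop_chain ?f - loop_chain ?g \<in> nullhom"
      by (simp add: loop_chain_window[OF b(1) r(1)] loop_chain_window[OF b(2) r(2)]
          window_props(3,4)[OF b(1) r(1)] window_props(3,4)[OF b(2) r(2)])
    then show ?case using Suc nullhom_trans by auto
  qed (simp add: nullhom_closed)
  from this[of m] show ?thesis using h(1,2) by simp
qed

text \<open>Reading a monomial additively as a 0-chain, the boundary of a move is a difference of
  two monomials. Along a walk these telescope, so a loop traces a cycle.\<close>

lemma token_step_in_L:
  assumes "adjr M N" "set_mset M \<subseteq> V"
  shows "token_step M N \<in> carrier (L 1)"
    "bdL 1 (token_step M N) = (\<Sum>x\<in>#N. frag_of (point x)) - (\<Sum>x\<in>#M. frag_of (point x))"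
proof -
  have "token_step M N \<in> carrier (L 1) \<and> bdL 1 (token_step M N) =
      (\<Sum>x\<in>#N. frag_of (point x)) - (\<Sum>x\<in>#M. frag_of (point x))"
  proof (cases "M = N")
    case True
    then show ?thesis by (simp add: L_closed bdL_simps)
  next
    case False
    then obtain u v g where "M = add_mset u g" "N = add_mset v g" "E u v"
      using assms(1) by (auto simp: adj_eq_def rpow_edge_def)
    moreover from this have "u \<noteq> v" "edge u v \<in> cubes V E 1"
      using not_E_refl E_in_V edge_in_cubes[of u v] by (auto simp: adj_eq_def)
    ultimately show ?thesis
      using L_closed(5)[of "edge u v" 1] by (simp add: token_step_move bdL_simps cube_bd_1[simplified])
  qed
  then show "token_step M N \<in> carrier (L 1)"
    "bdL 1 (token_step M N) = (\<Sum>x\<in>#N. frag_of (point x)) - (\<Sum>x\<in>#M. frag_of (point x))" by auto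
qed

lemma walk_sum_in_L:
  assumes "walk (rpow_edge E) w" "\<forall>M\<in>set w. set_mset M \<subseteq> V" "w \<noteq> []"
  shows "walk_sum token_step w \<in> carrier (L 1) \<and> bdL 1 (walk_sum token_step w) =
    (\<Sum>x\<in>#last w. frag_of (point x)) - (\<Sum>x\<in>#hd w. frag_of (point x))"
  using assms
proof (induction w rule: induct_list012)
  case (3 M N w)
  have "walk_sum token_step (N # w) \<in> carrier (L 1)"
    "bdL 1 (walk_sum token_step (N # w)) =
      (\<Sum>x\<in>#last (N # w). frag_of (point x)) - (\<Sum>x\<in>#N. frag_of (point x))"
    using "3.IH"(2) "3.prems" by auto
  moreover have "adjr M N" "set_mset M \<subseteq> V" using "3.prems" by auto
  ultimately show ?case
    using token_step_in_L[of M N] L_closed(2)[of "token_step M N" 1] by (simp add: bdL_simps)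
qed (auto simp: L_closed bdL_simps)

lemma loop_chain_cycle:
  assumes "based (rpow_verts V n) (rpow_edge E) M0 f"
  shows "loop_chain f \<in> cycles"
proof -
  have r: "\<forall>i. \<bar>i\<bar> \<ge> int (rad M0 f) \<longrightarrow> f i = M0" using rad_spec[OF assms] by blast
  note w = window_props[OF assms r]
  have "\<forall>M\<in>set (window (rad M0 f) f). set_mset M \<subseteq> V" using w(5) by (auto simp: rpow_verts_def)
  from walk_sum_in_L[OF w(1) this w(2)] show ?thesis
    by (simp add: w(3,4) cycles_def loop_chain_window[OF assms r])
qed

end

section \<open>Moving tokens independently\<close>

lemma walk_homotopic_replace_mid:
  assumes "p \<noteq> []" "q \<noteq> []" "adj_eq R (last p) x" "adj_eq R x (hd q)"
    "adj_eq R (last p) y" "adj_eq R y (hd q)"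
  shows "walk_homotopic R (p @ [x] @ q) (p @ [y] @ q)"
proof -
  have "p = butlast p @ [last p]" "q = hd q # tl q" using assms(1,2) by simp_all
  then have e: "p @ [z] @ q = butlast p @ [last p, z, hd q] @ tl q" for z
    by (metis append.assoc append_Cons append_Nil)
  show ?thesis unfolding e
    by (intro walk_homotopic_append1 walk_homotopic_append2 walk_homotopic.square assms)
qed

context simple_graph
begin

text \<open>Two distinct tokens moving along \<open>p\<close> and \<open>q\<close> span a grid of
  squares, and the two orders are the two ways around it. The induction sweeps one strip of the grid
  at a time, by \<open>walk_homotopic_ladder\<close>.\<close>

lemma walk_homotopic_swap:
  assumes "walk E p" "p \<noteq> []" "walk E q" "q \<noteq> []"
  shows "walk_homotopic (rpow_edge E)
    (map (\<lambda>x. add_mset x (add_mset (hd q) g)) p @ map (\<lambda>y. add_mset y (add_mset (last p) g)) q)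
    (map (\<lambda>y. add_mset y (add_mset (hd p) g)) q @ map (\<lambda>x. add_mset x (add_mset (last q) g)) p)"
  using assms(1,2)
proof (induction p)
  case (Cons b p)
  let ?f = "\<lambda>y. add_mset y (add_mset b g)"
  have last_f: "last (map ?f q) = add_mset b (add_mset (last q) g)"
    using assms(4) by (simp add: last_map add_mset_commute)
  show ?case
  proof (cases "p = []")
    case True
    have "hd (map ?f q) = add_mset b (add_mset (hd q) g)"
      using assms(4) by (simp add: hd_map add_mset_commute)
    then have "walk_homotopic (rpow_edge E) (add_mset b (add_mset (hd q) g) # map ?f q) (map ?f q)"
      using walk_homotopic_Cons_hd[of "map ?f q" "rpow_edge E"] assms(4) by simp
    also have "walk_homotopic (rpow_edge E) \<dots> (map ?f q @ [add_mset b (add_mset (last q) g)])"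
      using walk_homotopic.sym[OF walk_homotopic_snoc_last[of "map ?f q" "rpow_edge E"]] assms(4) last_f
      by simp
    finally show ?thesis using True by simp
  next
    case False
    then have adj: "adj_eq E b (hd p)" and w: "walk E p"
      using Cons.prems by (auto simp: successively_Cons)
    let ?f' = "\<lambda>y. add_mset y (add_mset (hd p) g)"
    let ?r = "map (\<lambda>x. add_mset x (add_mset (last q) g)) p"
    let ?l = "map (\<lambda>x. add_mset x (add_mset (hd q) g)) p @ map (\<lambda>y. add_mset y (add_mset (last p) g)) q"
    have "walk_homotopic (rpow_edge E) ([add_mset b (add_mset (hd q) g)] @ ?l)
        ([add_mset b (add_mset (hd q) g)] @ (map ?f' q @ ?r))"
      by (intro walk_homotopic_append2 Cons.IH w False)
    also have "\<dots> = (?f (hd q) # map ?f' q) @ ?r" by (simp add: add_mset_commute)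
    also have "walk_homotopic (rpow_edge E) \<dots> ((map ?f q @ [?f' (last q)]) @ ?r)"
      by (intro walk_homotopic_append1 walk_homotopic_ladder[where R = E] adjr_context
          adjr_add_mset adj assms(3,4))
    also have "\<dots> = map ?f q @ (?f' (last q) # ?r)" by simp
    also have "?f' (last q) = hd ?r" using False by (simp add: hd_map add_mset_commute)
    also have "walk_homotopic (rpow_edge E) (map ?f q @ (hd ?r # ?r)) (map ?f q @ ?r)"
      using False by (intro walk_homotopic_append2 walk_homotopic_Cons_hd) simp
    also have "walk_homotopic (rpow_edge E) (map ?f q @ ?r) ((map ?f q @ [last (map ?f q)]) @ ?r)"
      using assms(4) by (intro walk_homotopic_append1 walk_homotopic.sym[OF walk_homotopic_snoc_last])
        simp
    finally show ?thesis using False by (simp add: last_f)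
  qed
qed simp

end

section \<open>Sending tokens out from a root\<close>

locale rooted_graph = simple_graph +
  fixes a :: 'a
  assumes root: "a \<in> V"
begin

definition root_walk :: "'a \<Rightarrow> 'a list" where
  "root_walk v = (SOME p. p \<noteq> [] \<and> walk E p \<and> hd p = a \<and> last p = v)"

lemma root_walk:
  assumes "v \<in> V"
  shows "root_walk v \<noteq> []" "walk E (root_walk v)" "hd (root_walk v) = a" "last (root_walk v) = v"
proof -
  have "E\<^sup>*\<^sup>* a v" using sgraph root assms by (auto simp: sgraph_def)
  then have "\<exists>p. p \<noteq> [] \<and> walk E p \<and> hd p = a \<and> last p = v"
  proof (induction rule: rtranclp_induct)
    case base
    show ?case by (rule exI[of _ "[a]"]) simp
  next
    case (step y z)
    then obtain p where "p \<noteq> []" "walk E p" "hd p = a" "last p = y" by blast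
    with step(2) show ?case
      by (intro exI[of _ "p @ [z]"]) (auto simp: successively_append_iff adj_eq_def)
  qed
  from someI_ex[OF this]
  show "root_walk v \<noteq> []" "walk E (root_walk v)" "hd (root_walk v) = a" "last (root_walk v) = v"
    by (auto simp: root_walk_def)
qed

text \<open>These walks play the role of a spanning tree in the reduced power. One token moves at a
  time, so that \<open>walk_homotopic_swap\<close> can reorder them. The base case is the one-point
  walk at the empty monomial, which keeps every such list nonempty.\<close>

fun scatter :: "'a list \<Rightarrow> 'a multiset list" where
  "scatter [] = [{#}]"
| "scatter (x # xs) = map (\<lambda>y. add_mset y (replicate_mset (length xs) a)) (root_walk x)
     @ map (add_mset x) (scatter xs)"

lemma scatter:
  assumes "set xs \<subseteq> V"
  shows "scatter xs \<noteq> [] \<and> walk (rpow_edge E) (scatter xs) \<and>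
    hd (scatter xs) = replicate_mset (length xs) a \<and> last (scatter xs) = mset xs"
  using assms
proof (induction xs)
  case (Cons x xs)
  note p = root_walk[of x]
  have "walk (rpow_edge E) (map (\<lambda>y. add_mset y (replicate_mset (length xs) a)) (root_walk x))"
    using Cons.prems p by (intro walk_map[where R = E] adjr_add_mset) auto
  moreover have "walk (rpow_edge E) (map (add_mset x) (scatter xs))"
    using Cons by (intro walk_map[where R = "rpow_edge E"] adjr_context) auto
  ultimately show ?case
    using Cons p by (auto simp: successively_append_iff hd_map last_map)
qed simp

lemma scatter_swap:
  assumes "x \<in> V" "y \<in> V"
  shows "walk_homotopic (rpow_edge E) (scatter (x # y # zs)) (scatter (y # x # zs))"
proof -
  let ?g = "replicate_mset (length zs) a"
  note p = root_walk[OF assms(1)] and q = root_walk[OF assms(2)]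
  have e: "scatter (x # y # zs) =
    (map (\<lambda>t. add_mset t (add_mset a ?g)) (root_walk x) @ map (\<lambda>t. add_mset t (add_mset x ?g))
      (root_walk y))
      @ map (\<lambda>N. add_mset x (add_mset y N)) (scatter zs)" for x y
    by (simp add: add_mset_commute[of x] comp_def)
  have "walk_homotopic (rpow_edge E) (scatter (x # y # zs))
   ((map (\<lambda>t. add_mset t (add_mset a ?g)) (root_walk y) @ map (\<lambda>t. add_mset t (add_mset y ?g))
     (root_walk x))
      @ map (\<lambda>N. add_mset x (add_mset y N)) (scatter zs))"
    unfolding e using walk_homotopic_swap[OF p(2,1) q(2,1), of ?g]
    by (intro walk_homotopic_append1) (simp add: p q)
  also have "\<dots> = scatter (y # x # zs)"
    unfolding e by (simp add: add_mset_commute[of y])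
  finally show ?thesis .
qed

lemma scatter_remove1:
  "x \<in> set xs \<Longrightarrow> set xs \<subseteq> V \<Longrightarrow>
    walk_homotopic (rpow_edge E) (scatter xs) (scatter (x # remove1 x xs))"
proof (induction xs)
  case (Cons y ys)
  show ?case
  proof (cases "x = y")
    case True
    then show ?thesis by (simp add: walk_homotopic.refl)
  next
    case False
    then have x: "x \<in> set ys" using Cons.prems by auto
    have "length (x # remove1 x ys) = length ys"
      using x by (simp add: length_remove1 Suc_pred[OF length_pos_if_in_set])
    then have "walk_homotopic (rpow_edge E) (scatter (y # ys)) (scatter (y # x # remove1 x ys))"
      using Cons x walk_homotopic_map[OF adjr_context Cons.IH]
      by (simp del: scatter.simps(2) add: scatter.simps(2)[of y] walk_homotopic_append2)
    also have "walk_homotopic (rpow_edge E) \<dots> (scatter (x # y # remove1 x ys))"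
      using Cons.prems x by (intro scatter_swap) auto
    finally show ?thesis using False by simp
  qed
qed simp

text \<open>A monomial does not order its tokens; this makes the walk to it well defined up to
  homotopy. The entry wanted first is carried to the front by adjacent swaps.\<close>

lemma scatter_perm:
  "mset xs = mset ys \<Longrightarrow> set xs \<subseteq> V \<Longrightarrow> walk_homotopic (rpow_edge E) (scatter xs) (scatter ys)"
proof (induction xs arbitrary: ys)
  case Nil
  then show ?case by (simp add: walk_homotopic.refl)
next
  case (Cons x xs)
  have x: "x \<in> set ys" and ys: "set ys \<subseteq> V"
    using Cons.prems mset_eq_setD[OF Cons.prems(1)] by auto
  have m: "mset xs = mset (remove1 x ys)" using Cons.prems(1)[symmetric] by simp
  have "walk_homotopic (rpow_edge E) (scatter (x # xs)) (scatter (x # remove1 x ys))"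
    using walk_homotopic_map[OF adjr_context Cons.IH[OF m]] Cons.prems mset_eq_length[OF m]
    by (simp add: walk_homotopic_append2)
  also have "walk_homotopic (rpow_edge E) \<dots> (scatter ys)"
    by (rule walk_homotopic.sym[OF scatter_remove1[OF x ys]])
  finally show ?case .
qed

text \<open>Reorder both walks so that the moving token leaves first. The tokens of \<open>g\<close>
  then go out while it waits at \<open>u\<close> and come back while it waits at \<open>v\<close>.
  Sliding the move to a time before they leave makes their whole excursion cancel, and only the loop
  of one token is left.\<close>

lemma scatter_move:
  assumes "u \<in> V" "v \<in> V" "adj_eq E u v" "mset xs = add_mset u g" "mset ys = add_mset v g"
    "set_mset g \<subseteq> V"
  shows "walk_homotopic (rpow_edge E) (scatter xs @ rev (scatter ys))
    (map (\<lambda>t. add_mset t (replicate_mset (size g) a)) (root_walk u @ rev (root_walk v)))"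
proof -
  obtain gs where gs: "mset gs = g" using ex_mset by blast
  have xs: "set xs \<subseteq> V" and ys: "set ys \<subseteq> V" and gsV: "set gs \<subseteq> V"
    using assms(1,2,6) gs by (metis assms(4,5) insert_subset set_mset_add_mset_insert set_mset_mset)+
  have len: "length gs = size g" using gs by auto
  let ?k = "replicate_mset (size g) a"
  let ?p = "map (\<lambda>t. add_mset t ?k) (root_walk u)" and ?q = "map (\<lambda>t. add_mset t ?k) (root_walk v)"
  let ?r = "scatter gs"
  have r: "?r \<noteq> []" "walk (rpow_edge E) ?r" "hd ?r = ?k" using scatter[OF gsV] len by auto
  have "walk_homotopic (rpow_edge E) (scatter xs) (scatter (u # gs))"
    by (rule scatter_perm) (auto simp: assms(4) gs xs[simplified] subsetD[OF xs])
  moreover have "walk_homotopic (rpow_edge E) (scatter ys) (scatter (v # gs))"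
    by (rule scatter_perm) (auto simp: assms(5) gs subsetD[OF ys])
  ultimately have "walk_homotopic (rpow_edge E) (scatter xs @ rev (scatter ys))
      (scatter (u # gs) @ rev (scatter (v # gs)))"
    by (rule walk_homotopic.append[OF _ walk_homotopic_rev[OF symp_rpow]])
  also have "\<dots> = (?p @ map (add_mset u) ?r) @ rev (?q @ map (add_mset v) ?r)"
    by (simp add: len)
  also have "\<dots> = ?p @ (map (add_mset u) ?r @ rev (map (add_mset v) ?r)) @ rev ?q" by simp
  also have "walk_homotopic (rpow_edge E) \<dots> (?p @ [add_mset u ?k, add_mset v ?k] @ rev ?q)"
  proof (intro walk_homotopic_append1 walk_homotopic_append2)
    have hd_rev: "hd (rev (map (add_mset v) ?r)) = add_mset v (last ?r)"
      using r(1) by (simp add: hd_rev last_map)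
    \<comment> \<open>A pause after the move makes the step from \<open>u\<close> to
      \<open>v\<close> visible as the last rung of a ladder over \<open>?r\<close>; the ladder then
      carries it to the first rung.\<close>
    have "walk_homotopic (rpow_edge E) (map (add_mset u) ?r @ rev (map (add_mset v) ?r))
        (map (add_mset u) ?r @ (add_mset v (last ?r) # rev (map (add_mset v) ?r)))"
      using walk_homotopic.sym[OF walk_homotopic_Cons_hd[of "rev (map (add_mset v) ?r)"
        "rpow_edge E"]] r(1) hd_rev
      by (intro walk_homotopic_append2) simp
    also have "\<dots> = (map (add_mset u) ?r @ [add_mset v (last ?r)]) @ rev (map (add_mset v) ?r)" by simp
    also have "walk_homotopic (rpow_edge E) \<dots>
        ((add_mset u (hd ?r) # map (add_mset v) ?r) @ rev (map (add_mset v) ?r))"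
      by (intro walk_homotopic_append1 walk_homotopic.sym[OF walk_homotopic_ladder[where R =
        "rpow_edge E"]]
          adjr_context adjr_add_mset r assms(3))
    also have "\<dots> = [add_mset u ?k] @ (map (add_mset v) ?r @ rev (map (add_mset v) ?r))"
      by (simp add: r(3))
    also have "walk_homotopic (rpow_edge E) \<dots> ([add_mset u ?k] @ [hd (map (add_mset v) ?r)])"
      using r by (intro walk_homotopic_append2 walk_homotopic_append_rev symp_rpow
          walk_map[where R = "rpow_edge E"] adjr_context) auto
    also have "hd (map (add_mset v) ?r) = add_mset v ?k" using r by (simp add: hd_map)
    finally show "walk_homotopic (rpow_edge E) (map (add_mset u) ?r @ rev (map (add_mset v) ?r))
       [add_mset u ?k, add_mset v ?k]" by simp
  qed
  also have "?p @ [add_mset u ?k, add_mset v ?k] @ rev ?q = (?p @ [last ?p]) @ (hd (rev ?q) # rev ?q)"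
    using root_walk[OF assms(1)] root_walk[OF assms(2)] by (simp add: last_map hd_rev)
  also have "walk_homotopic (rpow_edge E) \<dots> (?p @ rev ?q)"
    using root_walk(1)[OF assms(1)] root_walk(1)[OF assms(2)]
    by (intro walk_homotopic.append walk_homotopic_snoc_last walk_homotopic_Cons_hd) auto
  finally show ?thesis by (simp add: rev_map)
qed

end

section \<open>The group of one-token loops\<close>

locale token_graph = rooted_graph +
  fixes n :: nat
  assumes n: "n \<ge> 2"
begin

abbreviation "R \<equiv> rpow_edge E"

definition one_token :: "'a list \<Rightarrow> 'a multiset list" where
  "one_token p = map (\<lambda>x. add_mset x (replicate_mset (n - 1) a)) p"

definition closed_walk :: "'a list \<Rightarrow> bool" where
  "closed_walk p \<longleftrightarrow> p \<noteq> [] \<and> walk E p \<and> hd p = a \<and> last p = a"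

definition walk_class :: "'a multiset list \<Rightarrow> 'a multiset list set" where
  "walk_class w = {w'. walk_homotopic R w w'}"

text \<open>In substance, the image of the fundamental group of the graph at \<open>a\<close> in
  that of the reduced power at the root monomial. Since walks may pause, the product of
  representatives is plain append.\<close>

definition token_group :: "'a multiset list set monoid" where
  "token_group = \<lparr>carrier = {walk_class (one_token p) | p. closed_walk p},
     mult = (\<lambda>X Y. walk_class ((SOME x. x \<in> X) @ (SOME y. y \<in> Y))),
     one = walk_class (one_token [a])\<rparr>"

lemma walk_class_eq_iff: "walk_class w = walk_class w' \<longleftrightarrow> walk_homotopic R w w'"
proof
  assume "walk_class w = walk_class w'"
  moreover have "w' \<in> walk_class w'" by (simp add: walk_class_def walk_homotopic.refl)
  ultimately have "w' \<in> walk_class w" by simp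
  then show "walk_homotopic R w w'" by (simp add: walk_class_def)
next
  assume h: "walk_homotopic R w w'"
  show "walk_class w = walk_class w'"
    using walk_homotopic.trans[OF h] walk_homotopic.trans[OF walk_homotopic.sym[OF h]]
    by (auto simp: walk_class_def)
qed

lemma walk_class_mult: "walk_class w \<otimes>\<^bsub>token_group\<^esub> walk_class w' = walk_class (w @ w')"
proof -
  have "(SOME x. x \<in> walk_class w) \<in> walk_class w" for w
    by (rule someI[of _ w]) (simp add: walk_class_def walk_homotopic.refl)
  then have "walk_homotopic R (w @ w') ((SOME x. x \<in> walk_class w) @ (SOME x. x \<in> walk_class w'))"
    by (intro walk_homotopic.append) (auto simp: walk_class_def)
  then show ?thesis by (simp add: token_group_def walk_class_eq_iff walk_homotopic.sym)
qed

lemma one_token_append: "one_token (p @ q) = one_token p @ one_token q"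
  by (simp add: one_token_def)

lemma one_token_rev: "one_token (rev p) = rev (one_token p)"
  by (simp add: one_token_def rev_map)

lemma one_token_homotopic: "walk_homotopic E p q \<Longrightarrow> walk_homotopic R (one_token p) (one_token q)"
  unfolding one_token_def by (rule walk_homotopic_map[OF adjr_add_mset])

lemma closed_walk_simps:
  "closed_walk [a]" "closed_walk p \<Longrightarrow> closed_walk q \<Longrightarrow> closed_walk (p @ q)"
  "closed_walk p \<Longrightarrow> closed_walk (rev p)"
  by (auto simp: closed_walk_def successively_append_iff walk_rev symE hd_rev last_rev simp del:
    successively_rev)

lemma carrier_token_group: "closed_walk p \<Longrightarrow> walk_class (one_token p) \<in> carrier token_group"
  by (auto simp: token_group_def)

lemma one_token_group: "\<one>\<^bsub>token_group\<^esub> = walk_class (one_token [a])"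
  by (simp add: token_group_def)

lemma comm_group_token_group: "comm_group token_group"
proof (rule comm_groupI)
  fix X Y Z assume "X \<in> carrier token_group" "Y \<in> carrier token_group" "Z \<in> carrier token_group"
  then obtain p q r where pqr: "X = walk_class (one_token p)" "closed_walk p"
    "Y = walk_class (one_token q)" "closed_walk q" "Z = walk_class (one_token r)" "closed_walk r"
    by (auto simp: token_group_def)
  show "X \<otimes>\<^bsub>token_group\<^esub> Y \<in> carrier token_group"
    using carrier_token_group[OF closed_walk_simps(2)[OF pqr(2,4)]]
    by (simp add: pqr walk_class_mult one_token_append)
  show "X \<otimes>\<^bsub>token_group\<^esub> Y \<otimes>\<^bsub>token_group\<^esub> Z = X \<otimes>\<^bsub>token_group\<^esub> (Y \<otimes>\<^bsub>token_group\<^esub> Z)"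
    by (simp add: pqr walk_class_mult)
  \<comment> \<open>Since \<open>n \<ge> 2\<close>, the second loop can be run by another token.\<close>
  have "replicate_mset (n - 1) a = add_mset a (replicate_mset (n - 2) a)"
    using n by (cases n) (auto simp flip: replicate_mset_Suc simp: Suc_diff_Suc numeral_2_eq_2)
  \<comment> \<open>Tokens carry no names: while the first one rests at \<open>a\<close>, the second
    traces literally the same list \<open>one_token q\<close>.\<close>
  then show "X \<otimes>\<^bsub>token_group\<^esub> Y = Y \<otimes>\<^bsub>token_group\<^esub> X"
    using walk_homotopic_swap[of p q "replicate_mset (n - 2) a"] pqr(2,4)
    by (simp add: pqr walk_class_mult walk_class_eq_iff one_token_def closed_walk_def)
next
  show "\<one>\<^bsub>token_group\<^esub> \<in> carrier token_group"
    by (simp add: one_token_group carrier_token_group closed_walk_simps)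
next
  fix X assume "X \<in> carrier token_group"
  then obtain p where p: "X = walk_class (one_token p)" "closed_walk p"
    by (auto simp: token_group_def)
  have "walk_homotopic E ([a] @ p) p"
    using walk_homotopic_Cons_hd[of p E] p(2) by (simp add: closed_walk_def)
  then show "\<one>\<^bsub>token_group\<^esub> \<otimes>\<^bsub>token_group\<^esub> X = X"
    using one_token_homotopic
      by (simp only: p one_token_group walk_class_mult walk_class_eq_iff flip: one_token_append)
  have "walk_homotopic E (rev p @ p) [a]"
    using walk_homotopic_rev_append[OF symE, of p] p(2) by (simp add: closed_walk_def)
  then show "\<exists>Y\<in>carrier token_group. Y \<otimes>\<^bsub>token_group\<^esub> X = \<one>\<^bsub>token_group\<^esub>"
    using one_token_homotopic p
    by (intro bexI[of _ "walk_class (one_token (rev p))"])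
      (simp_all only: one_token_group walk_class_mult walk_class_eq_iff closed_walk_simps(3)
        carrier_token_group flip: one_token_append)
qed

section \<open>Extending edge loops to a homomorphism on 1-chains\<close>

lemma group_hom_token_group: "h \<in> hom (L 1) token_group \<Longrightarrow> group_hom (L 1) token_group h"
  by (simp only: group_hom_def group_hom_axioms_def group_L
      comm_group.axioms(2)[OF comm_group_token_group] simp_thms)

text \<open>The edge from \<open>u\<close> to \<open>v\<close> is crossed at the seam of the
  append.\<close>

definition edge_loop :: "'a \<Rightarrow> 'a \<Rightarrow> 'a list" where
  "edge_loop u v = root_walk u @ rev (root_walk v)"

lemma closed_walk_edge_loop:
  assumes "u \<in> V" "adj_eq E u v" shows "closed_walk (edge_loop u v)"
  using root_walk[OF assms(1)] root_walk[of v] assms adj_eq_in_V[OF assms(2)] walk_rev[OF symE]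
  by (simp add: closed_walk_def edge_loop_def successively_append_iff hd_rev last_rev del:
    successively_rev)

lemma edge_loop_refl:
  assumes "u \<in> V" shows "walk_homotopic E (edge_loop u u) [a]"
  using walk_homotopic_append_rev[OF symE root_walk(2,1)[OF assms]] root_walk(3)[OF assms]
  by (simp add: edge_loop_def)

lemma edge_loop_append:
  assumes "u \<in> V" "v \<in> V" "w \<in> V"
  shows "walk_homotopic E (edge_loop u v @ edge_loop v w) (root_walk u @ [v] @ rev (root_walk w))"
proof -
  have "walk_homotopic E (root_walk u @ (rev (root_walk v) @ root_walk v) @ rev (root_walk w))
      (root_walk u @ [last (root_walk v)] @ rev (root_walk w))"
    by (intro walk_homotopic_append1 walk_homotopic_append2 walk_homotopic_rev_append symE root_walk
      assms)
  then show ?thesis by (simp add: edge_loop_def root_walk assms)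
qed

text \<open>Once the return trips at the intermediate vertex cancel, the two sides differ in that
  vertex alone, which is one square.\<close>

lemma edge_loop_square:
  assumes "x \<in> V" "adj_eq E x y" "adj_eq E y z" "adj_eq E x y'" "adj_eq E y' z"
  shows "walk_homotopic E (edge_loop x y @ edge_loop y z) (edge_loop x y' @ edge_loop y' z)"
proof -
  have V: "y \<in> V" "y' \<in> V" "z \<in> V" using assms adj_eq_in_V by blast+
  have "walk_homotopic E (edge_loop x y @ edge_loop y z) (root_walk x @ [y] @ rev (root_walk z))"
    by (intro edge_loop_append assms V)
  also have "walk_homotopic E \<dots> (root_walk x @ [y'] @ rev (root_walk z))"
    using root_walk[OF assms(1)] root_walk[OF V(3)] assms
    by (intro walk_homotopic_replace_mid) (auto simp: hd_rev)
  also have "walk_homotopic E \<dots> (edge_loop x y' @ edge_loop y' z)"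
    by (intro walk_homotopic.sym[OF edge_loop_append] assms V)
  finally show ?thesis .
qed

text \<open>The universal property of the free abelian group extends \<open>edge_loop\<close> to
  chains; here the commutativity of \<open>token_group\<close> enters. Degenerate edges die by
  \<open>edge_loop_refl\<close>, and boundaries die because \<open>edge_loop_square\<close>
  identifies the two paths of a square.\<close>

lemma ex_loop_hom:
  obtains h where "h \<in> hom (L 1) token_group"
    "\<And>u v. u \<in> V \<Longrightarrow> adj_eq E u v \<Longrightarrow> h (ed u v) = walk_class (one_token (edge_loop u v))"
    "\<And>c. c \<in> nullhom \<Longrightarrow> h c = \<one>\<^bsub>token_group\<^esub>"
proof -
  interpret T: comm_group token_group by (rule comm_group_token_group)
  have "(\<lambda>f. walk_class (one_token (edge_loop (f [False]) (f [True])))) ` cubes V E 1 \<subseteq> carrier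
    token_group"
    by (auto elim!: cubes_1E[simplified] intro!: carrier_token_group closed_walk_edge_loop)
  from T.free_Abelian_group_universal[OF this]
  obtain h where h: "h \<in> hom (L 1) token_group"
    "\<And>f. f \<in> cubes V E 1 \<Longrightarrow> h (frag_of f) = walk_class (one_token (edge_loop (f [False]) (f [True])))"
    unfolding Lgrp_def by metis
  interpret h: group_hom "L 1" token_group h
    by (rule group_hom_token_group[OF h(1)])
  have h_edge: "h (ed u v) = walk_class (one_token (edge_loop u v))" if "u \<in> V" "adj_eq E u v" for u v
    using h(2)[OF edge_in_cubes[OF that]] by simp
  have h_add: "h (x + y) = h x \<otimes>\<^bsub>token_group\<^esub> h y" if "x \<in> carrier (L 1)" "y \<in> carrier (L 1)" for x y
    using h.hom_mult[OF that] by simp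
  have h_diff: "h (x - y) = h x \<otimes>\<^bsub>token_group\<^esub> inv\<^bsub>token_group\<^esub> h y"
    if "x \<in> carrier (L 1)" "y \<in> carrier (L 1)" for x y
    using h_add[OF that(1) L_closed(3)[OF that(2)]] h.hom_inv[OF that(2)] inv_L[OF that(2)] by simp
  have h_zero: "h 0 = \<one>\<^bsub>token_group\<^esub>" using h.hom_one by simp
  have hD: "d \<in> carrier (L 1) \<and> h d = \<one>\<^bsub>token_group\<^esub>" if "d \<in> D 1" for d
    using that
  proof (induction rule: D_induct)
    case (gen f)
    obtain u v where "f = edge u v" and u: "u \<in> V" using cubes_1E[OF gen(1)] by blast
    with gen(2) have u: "f = edge u u" "u \<in> V" by (simp_all add: degenerate_1[simplified])
    have "h (frag_of f) = \<one>\<^bsub>token_group\<^esub>"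
      unfolding u(1) h_edge[OF u(2) adj_eq_refl] one_token_group walk_class_eq_iff
      by (intro one_token_homotopic edge_loop_refl u)
    then show ?case using gen by (simp add: L_closed)
  next
    case (minus d)
    then show ?case using h_diff[of 0 d] L_closed(1)[of 1] L_closed(3)[of d 1] h_zero by simp
  next
    case (add d d')
    then show ?case using h_add[of d d'] L_closed(2)[of d 1 d'] by simp
  qed (simp add: L_closed h_zero)
  have hB: "h (bdL 2 s) = \<one>\<^bsub>token_group\<^esub>" if "s \<in> carrier (L 2)" for s
  proof -
    have "bdL 2 s \<in> carrier (L 1) \<and> h (bdL 2 s) = \<one>\<^bsub>token_group\<^esub>"
      using that[unfolded carrier_L]
    proof (induction rule: frag_induction)
      case zero
      then show ?case by (simp add: bdL_simps L_closed h_zero)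
    next
      case (one f)
      note f = cubes_2D[OF one]
      let ?x = "f [False, False]" and ?y = "f [True, False]" and ?y' = "f [False, True]"
        and ?z = "f [True, True]"
      have in_L: "ed ?x ?y \<in> carrier (L 1)" "ed ?y ?z \<in> carrier (L 1)" "ed ?x ?y' \<in> carrier (L 1)"
        "ed ?y' ?z \<in> carrier (L 1)"
        by (intro L_closed(5)[THEN iffD2] edge_in_cubes f)+
      have eq: "h (ed ?x ?y + ed ?y ?z) = h (ed ?x ?y' + ed ?y' ?z)"
        unfolding h_add[OF in_L(1,2)] h_add[OF in_L(3,4)]
        unfolding h_edge[OF f(1,6)] h_edge[OF f(3,8)] h_edge[OF f(1,5)] h_edge[OF f(2,7)]
        unfolding walk_class_mult walk_class_eq_iff one_token_append[symmetric]
        by (intro one_token_homotopic edge_loop_square f)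
      have bd: "bdL 2 (frag_of f) = (ed ?x ?y + ed ?y ?z) - (ed ?x ?y' + ed ?y' ?z)"
        by (simp add: bdL_simps cube_bd_2)
      have "h (bdL 2 (frag_of f)) = \<one>\<^bsub>token_group\<^esub>"
        unfolding bd h_diff[OF L_closed(2)[OF in_L(1,2)] L_closed(2)[OF in_L(3,4)]] eq
        by (rule T.r_inv[OF h.hom_closed[OF L_closed(2)[OF in_L(3,4)]]])
      then show ?case using one by (simp add: bdL_2_in_L[simplified] L_closed)
    next
      case (diff x y)
      then show ?case using h_diff[of "bdL 2 x" "bdL 2 y"] L_closed(4)[of "bdL 2 x" 1]
        by (simp add: bdL_simps)
    qed
    then show ?thesis by blast
  qed
  have "h c = \<one>\<^bsub>token_group\<^esub>" if c: "c \<in> nullhom" for c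
  proof -
    obtain d s where "c = d + bdL 2 s" "d \<in> D 1" "s \<in> carrier (L 2)"
      using c by (auto simp: nullhom_def)
    then show ?thesis using h_add[of d "bdL 2 s"] hD hB[of s] bdL_2_in_L[of s] by simp
  qed
  with h(1) h_edge show thesis by (rule that)
qed

section \<open>Recovering a walk from its chain\<close>

definition root_to :: "'a multiset \<Rightarrow> 'a multiset list" where
  "root_to M = scatter (SOME xs. mset xs = M)"

lemma root_to_eq: "\<exists>xs. root_to M = scatter xs \<and> mset xs = M"
  unfolding root_to_def using someI_ex[OF ex_mset[of M]] by blast

lemma root_to:
  assumes "M \<in> rpow_verts V n"
  shows "root_to M \<noteq> []" "walk R (root_to M)" "one_token [a] = [hd (root_to M)]" "last (root_to M) = M"
proof -
  obtain xs where xs: "root_to M = scatter xs" "mset xs = M" using root_to_eq by blast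
  have "set xs \<subseteq> V" "length xs = n" using assms xs(2) by (auto simp: rpow_verts_def)
  moreover have "add_mset a (replicate_mset (n - 1) a) = replicate_mset n a"
    using n by (cases n) auto
  ultimately show "root_to M \<noteq> []" "walk R (root_to M)" "one_token [a] = [hd (root_to M)]"
    "last (root_to M) = M"
    using scatter[of xs] xs by (auto simp: one_token_def)
qed

lemma root_to_cancel:
  assumes "M \<in> rpow_verts V n"
  shows "walk_homotopic R (root_to M @ rev (root_to M)) (one_token [a])"
    "walk_homotopic R (rev (root_to M) @ root_to M) [M]"
  using walk_homotopic_append_rev[OF symp_rpow root_to(2,1)[OF assms]]
    walk_homotopic_rev_append[OF symp_rpow root_to(2,1)[OF assms]] root_to(3,4)[OF assms] by auto

text \<open>Between any two moves insert the trip to the root monomial and back. The walk falls into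
  pieces \<open>root_to M @ rev (root_to N)\<close>, each a one-token loop by
  \<open>scatter_move\<close>, and \<open>h\<close> takes exactly this value on the move.\<close>

lemma loop_hom_walk:
  assumes h: "h \<in> hom (L 1) token_group"
    "\<And>u v. u \<in> V \<Longrightarrow> adj_eq E u v \<Longrightarrow> h (ed u v) = walk_class (one_token (edge_loop u v))"
    and w: "walk R w" "set w \<subseteq> rpow_verts V n" "w \<noteq> []"
  shows "h (walk_sum token_step w) = walk_class (root_to (hd w) @ w @ rev (root_to (last w)))"
  using w
proof (induction w rule: induct_list012)
  case (2 M)
  interpret h: group_hom "L 1" token_group h
    by (rule group_hom_token_group[OF h(1)])
  have M: "M \<in> rpow_verts V n" using 2 by simp
  have "walk_homotopic R (root_to M @ rev (root_to M)) ((root_to M @ [M]) @ rev (root_to M))"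
    using walk_homotopic_snoc_last[OF root_to(1)[OF M], of R] root_to(4)[OF M]
    by (intro walk_homotopic_append1) (simp add: walk_homotopic.sym)
  then have "walk_homotopic R (one_token [a]) (root_to M @ [M] @ rev (root_to M))"
    using walk_homotopic.trans[OF walk_homotopic.sym[OF root_to_cancel(1)[OF M]]] by simp
  then show ?case using h.hom_one by (simp add: one_token_group walk_class_eq_iff)
next
  case (3 M N w)
  have M: "M \<in> rpow_verts V n" and N: "N \<in> rpow_verts V n" and adj: "adjr M N" using "3.prems" by auto
  have inV: "\<forall>M\<in>set (M # N # w). set_mset M \<subseteq> V" using "3.prems" by (auto simp: rpow_verts_def)
  let ?t = "(N # w) @ rev (root_to (last (N # w)))"
  have step: "h (token_step M N) = walk_class (root_to M @ rev (root_to N))"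
  proof (cases "M = N")
    case True
    interpret h: group_hom "L 1" token_group h
      by (rule group_hom_token_group[OF h(1)])
    show ?thesis
      using h.hom_one walk_homotopic.sym[OF root_to_cancel(1)[OF N]]
      by (simp add: True one_token_group walk_class_eq_iff)
  next
    case False
    obtain u v g where g: "M = add_mset u g" "N = add_mset v g" "adj_eq E u v" "u \<in> V" "v \<in> V"
    proof (rule adjrE[OF adj])
      show "M \<noteq> {#}" "set_mset M \<subseteq> V" using M n by (auto simp: rpow_verts_def)
    qed
    obtain xs ys where xs: "root_to M = scatter xs" "mset xs = M" and ys: "root_to N = scatter ys"
      "mset ys = N"
      using root_to_eq by blast
    have "size g = n - 1" "set_mset g \<subseteq> V" using M g(1) by (auto simp: rpow_verts_def)
    then have "walk_homotopic R (root_to M @ rev (root_to N)) (one_token (edge_loop u v))"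
      using scatter_move[OF g(4,5,3), of xs g ys] xs ys g by (simp add: one_token_def edge_loop_def)
    moreover have "token_step M N = ed u v" using False g by (simp add: token_step_move)
    ultimately show ?thesis using h(2)[OF g(4,3)] by (simp add: walk_class_eq_iff walk_homotopic.sym)
  qed
  have IH: "h (walk_sum token_step (N # w)) = walk_class (root_to N @ ?t)"
    using "3.IH"(2) "3.prems" by simp
  have in_L: "token_step M N \<in> carrier (L 1)" "walk_sum token_step (N # w) \<in> carrier (L 1)"
    using token_step_in_L(1)[OF adj] walk_sum_in_L[of "N # w"] inV "3.prems"(1) by auto
  have "h (walk_sum token_step (M # N # w)) =
    walk_class ((root_to M @ rev (root_to N)) @ root_to N @ ?t)"
    using hom_mult[OF h(1) in_L] by (simp add: step IH walk_class_mult)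
  also have "\<dots> = walk_class (root_to M @ M # ?t)"
  proof (unfold walk_class_eq_iff)
    have "walk_homotopic R (root_to M @ (rev (root_to N) @ root_to N) @ ?t) (root_to M @ [N] @ ?t)"
      by (intro walk_homotopic_append1 walk_homotopic_append2 root_to_cancel N)
    also have "walk_homotopic R \<dots> (root_to M @ ?t)"
      using walk_homotopic_Cons_hd[of ?t R] by (intro walk_homotopic_append2) simp
    also have "walk_homotopic R \<dots> ((root_to M @ [M]) @ ?t)"
      using walk_homotopic.sym[OF walk_homotopic_snoc_last[OF root_to(1)[OF M], of R]] root_to(4)[OF M]
      by (intro walk_homotopic_append1) simp
    finally show "walk_homotopic R ((root_to M @ rev (root_to N)) @ root_to N @ ?t) (root_to M @ M # ?t)"
      by simp
  qed
  finally show ?case by simp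
qed simp

text \<open>The homomorphism \<open>h\<close> sees only the homology class, and
  \<open>loop_hom_walk\<close> reads off from its value the walk conjugated by
  \<open>root_to M\<close>. Conjugating back gives the walk itself.\<close>

lemma homologous_imp_homotopic:
  assumes "walk R w" "set w \<subseteq> rpow_verts V n" "w \<noteq> []" "hd w = M" "last w = M"
    and "walk R w'" "set w' \<subseteq> rpow_verts V n" "w' \<noteq> []" "hd w' = M" "last w' = M"
    and "walk_sum token_step w - walk_sum token_step w' \<in> nullhom"
  shows "walk_homotopic R w w'"
proof -
  obtain h where h: "h \<in> hom (L 1) token_group"
    "\<And>u v. u \<in> V \<Longrightarrow> adj_eq E u v \<Longrightarrow> h (ed u v) = walk_class (one_token (edge_loop u v))"
    "\<And>c. c \<in> nullhom \<Longrightarrow> h c = \<one>\<^bsub>token_group\<^esub>"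
    using ex_loop_hom by blast
  interpret h: group_hom "L 1" token_group h
    by (rule group_hom_token_group[OF h(1)])
  have M: "M \<in> rpow_verts V n" using assms(2,3,4) by auto
  let ?c = "walk_sum token_step w" and ?c' = "walk_sum token_step w'"
  have "\<forall>M\<in>set w. set_mset M \<subseteq> V" "\<forall>M\<in>set w'. set_mset M \<subseteq> V"
    using assms(2,7) by (auto simp: rpow_verts_def)
  then have in_L: "?c \<in> carrier (L 1)" "?c' \<in> carrier (L 1)"
    using walk_sum_in_L[OF assms(1) _ assms(3)] walk_sum_in_L[OF assms(6) _ assms(8)] by blast+
  have "h ?c = h ((?c - ?c') + ?c')" by simp
  also have "\<dots> = h (?c - ?c') \<otimes>\<^bsub>token_group\<^esub> h ?c'"
    using h.hom_mult[OF L_closed(4)[OF in_L] in_L(2)] by simp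
  also have "\<dots> = h ?c'" using h(3)[OF assms(11)] h.hom_closed[OF in_L(2)] by simp
  finally have "walk_homotopic R (root_to M @ w @ rev (root_to M)) (root_to M @ w' @ rev (root_to M))"
    using loop_hom_walk[OF h(1,2) assms(1-3)] loop_hom_walk[OF h(1,2) assms(6-8)] assms(4,5,9,10)
    by (simp add: walk_class_eq_iff)
  then have conj: "walk_homotopic R (rev (root_to M) @ (root_to M @ w @ rev (root_to M)) @ root_to M)
      (rev (root_to M) @ (root_to M @ w' @ rev (root_to M)) @ root_to M)"
    by (rule walk_homotopic_append2[OF walk_homotopic_append1])
  have reduce: "walk_homotopic R (rev (root_to M) @ (root_to M @ w @ rev (root_to M)) @ root_to M) w"
    if "w \<noteq> []" "hd w = M" "last w = M" for w
  proof -
    have "walk_homotopic R ((rev (root_to M) @ root_to M) @ w @ (rev (root_to M) @ root_to M))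
      ([M] @ w @ [M])"
      by (intro walk_homotopic.append walk_homotopic.refl root_to_cancel M)
    also have "walk_homotopic R \<dots> (w @ [M])"
      using walk_homotopic_append1[OF walk_homotopic_Cons_hd[OF that(1)]] that(2) by simp
    also have "walk_homotopic R \<dots> w"
      using walk_homotopic_snoc_last[OF that(1)] that(3) by simp
    finally show ?thesis by simp
  qed
  have "walk_homotopic R w (rev (root_to M) @ (root_to M @ w @ rev (root_to M)) @ root_to M)"
    by (rule walk_homotopic.sym[OF reduce[OF assms(3-5)]])
  also note conj
  also have "walk_homotopic R (rev (root_to M) @ (root_to M @ w' @ rev (root_to M)) @ root_to M) w'"
    by (rule reduce[OF assms(8-10)])
  finally show ?thesis .
qed

section \<open>Every cycle is traced by a loop\<close>

lemma one_token_walk: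
  assumes "walk E p" "p \<noteq> []" "hd p \<in> V"
  shows "walk R (one_token p)" "set (one_token p) \<subseteq> rpow_verts V n"
proof -
  show "walk R (one_token p)"
    unfolding one_token_def by (rule walk_map[OF adjr_add_mset assms(1)])
  interpret symmetric_graph V E by unfold_locales (auto simp: symE E_in_V)
  have "set p \<subseteq> V" using walk_in_verts[of "hd p" "tl p"] assms by (cases p) auto
  then show "set (one_token p) \<subseteq> rpow_verts V n"
    using n root by (auto simp: one_token_def rpow_verts_def split: if_splits)
qed

text \<open>The induction over chains passes through chains that are not cycles, so the statement
  carries a correction: the chains of the root walks to the points of the boundary. It vanishes on
  cycles. In it \<open>x []\<close> is the vertex of the 0-cube \<open>x\<close>.\<close>

lemma ex_loop_homologous:
  assumes "c \<in> carrier (L 1)"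
  shows "\<exists>p. closed_walk p \<and> walk_sum token_step (one_token p) -
    (c - frag_extend (\<lambda>x. walk_sum token_step (one_token (root_walk (x [])))) (bdL 1 c)) \<in> nullhom"
proof -
  define \<sigma> where "\<sigma> = frag_extend (\<lambda>x :: bool list \<Rightarrow> 'a. walk_sum token_step (one_token (root_walk (x
    []))))"
  have rev0: "walk_sum token_step (one_token p) + walk_sum token_step (rev (one_token p)) \<in> nullhom"
    if "walk E p" "p \<noteq> []" "hd p \<in> V" for p
    using walk_sum_rev[OF one_token_walk[OF that]] n by simp
  have "\<exists>p. closed_walk p \<and> walk_sum token_step (one_token p) - (c - \<sigma> (bdL 1 c)) \<in> nullhom"
    using assms[unfolded carrier_L]
  proof (induction rule: frag_induction)
    case zero
    show ?case
      by (rule exI[of _ "[a]"]) (simp add: closed_walk_simps one_token_def bdL_simps \<sigma>_def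
        nullhom_closed)
  next
    \<comment> \<open>The loop is \<open>edge_loop u v\<close>: its chain is the edge plus the root
      walk to \<open>u\<close> minus the root walk to \<open>v\<close>, up to
      \<open>nullhom\<close>.\<close>
    case (one f)
    then obtain u v where uv: "f = edge u v" "u \<in> V" "v \<in> V" "adj_eq E u v" by (rule cubes_1E)
    note p = root_walk[OF uv(2)] and q = root_walk[OF uv(3)]
    let ?p = "one_token (root_walk u)" and ?q = "one_token (root_walk v)"
    let ?k = "replicate_mset (n - 1) a"
    have ne: "?p \<noteq> []" "rev ?q \<noteq> []" "last ?p = add_mset u ?k" "hd (rev ?q) = add_mset v ?k"
      using p q by (auto simp: one_token_def last_map hd_rev)
    have "one_token (edge_loop u v) = ?p @ rev ?q"
      by (simp add: edge_loop_def one_token_def rev_map)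
    then have ws: "walk_sum token_step (one_token (edge_loop u v)) = walk_sum token_step ?p
        + token_step (add_mset u ?k) (add_mset v ?k) + walk_sum token_step (rev ?q)"
      using walk_sum_append[OF ne(1,2)] ne(3,4) by simp
    have s: "\<sigma> (bdL 1 (frag_of f)) = walk_sum token_step ?q - walk_sum token_step ?p"
      by (simp add: \<sigma>_def uv(1) bdL_simps cube_bd_1[simplified] frag_extend_diff)
    have "(token_step (add_mset u ?k) (add_mset v ?k) - ed u v)
        + (walk_sum token_step ?q + walk_sum token_step (rev ?q)) \<in> nullhom"
      using q root by (intro nullhom_closed(2) token_step_homologous uv rev0) auto
    then have "walk_sum token_step (one_token (edge_loop u v)) - (frag_of f - \<sigma> (bdL 1 (frag_of f))) \<in>
      nullhom"
      unfolding ws s by (simp add: uv(1) algebra_simps)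
    then show ?case using closed_walk_edge_loop[OF uv(2,4)] by blast
  next
    case (diff x y)
    then obtain p q where p: "closed_walk p"
      "walk_sum token_step (one_token p) - (x - \<sigma> (bdL 1 x)) \<in> nullhom"
      and q: "closed_walk q" "walk_sum token_step (one_token q) - (y - \<sigma> (bdL 1 y)) \<in> nullhom" by blast
    have ne: "one_token p \<noteq> []" "rev (one_token q) \<noteq> []" "last (one_token p) = hd (rev (one_token q))"
      using p(1) q(1) by (auto simp: one_token_def closed_walk_def last_map hd_rev)
    have ws: "walk_sum token_step (one_token (p @ rev q)) =
      walk_sum token_step (one_token p) + walk_sum token_step (rev (one_token q))"
      using walk_sum_append[OF ne(1,2), of token_step] ne(3)
      by (simp add: one_token_append one_token_rev)
    have s: "\<sigma> (bdL 1 (x - y)) = \<sigma> (bdL 1 x) - \<sigma> (bdL 1 y)"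
      by (simp add: \<sigma>_def bdL_simps frag_extend_diff)
    have "walk_sum token_step (one_token q) + walk_sum token_step (rev (one_token q)) \<in> nullhom"
      using q(1) root by (intro rev0) (auto simp: closed_walk_def)
    from nullhom_closed(2)[OF nullhom_closed(4)[OF p(2) q(2)] this]
    have "walk_sum token_step (one_token (p @ rev q)) - ((x - y) - \<sigma> (bdL 1 (x - y))) \<in> nullhom"
      unfolding ws s by (simp add: algebra_simps)
    then show ?case using closed_walk_simps(2)[OF p(1) closed_walk_simps(3)[OF q(1)]] by blast
  qed
  then show ?thesis by (simp add: \<sigma>_def)
qed

lemma cycle_homologous_loop:
  assumes "c \<in> cycles" "M \<in> rpow_verts V n"
  obtains f where "based (rpow_verts V n) R M f" "loop_chain f - c \<in> nullhom"
proof -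
  obtain p where p: "closed_walk p" "walk_sum token_step (one_token p) - c \<in> nullhom"
    using ex_loop_homologous[of c] assms(1) by (auto simp: cycles_def)
  note q = root_to[OF assms(2)]
  let ?q = "root_to M" and ?p = "one_token p"
  have n0: "n > 0" using n by simp
  have x0: "[hd ?q] = [add_mset a (replicate_mset (n - 1) a)]" using q(3) by (simp add: one_token_def)
  have pp: "?p \<noteq> []" "hd ?p = hd ?q" "last ?p = hd ?q"
    using p(1) x0 by (auto simp: one_token_def closed_walk_def hd_map last_map)
  have wp: "walk R ?p" "set ?p \<subseteq> rpow_verts V n"
    using one_token_walk[of p] p(1) root by (auto simp: closed_walk_def)
  \<comment> \<open>The loop \<open>?p\<close> is based at the root monomial. Conjugation by
    \<open>?q\<close> moves it to \<open>M\<close>, and the two chains this adds cancel up to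
    \<open>nullhom\<close>.\<close>
  define w where "w = rev ?q @ ?p @ ?q"
  have w: "w \<noteq> []" "hd w = M" "last w = M" using q pp by (auto simp: w_def hd_rev)
  have "walk R w"
    using walk_rev[OF symp_rpow q(2)] q wp pp
    by (simp add: w_def successively_append_iff last_rev del: successively_rev)
  then have walk: "walk R (M # w @ [M])" using w by (rule walk_pad)
  have verts: "set w \<subseteq> rpow_verts V n"
    using symmetric_graph.walk_in_verts[OF symmetric_graph_rpow walk assms(2)] by auto
  have "walk_sum token_step w =
    walk_sum token_step (rev ?q) + walk_sum token_step ?p + walk_sum token_step ?q"
    using walk_sum_append[of "rev ?q" "?p @ ?q" token_step] walk_sum_append[of ?p ?q token_step] q pp
    by (simp add: w_def last_rev)
  moreover have "walk_sum token_step ?q + walk_sum token_step (rev ?q) \<in> nullhom"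
    using verts by (intro walk_sum_rev[OF q(2) _ n0]) (auto simp: w_def)
  ultimately have "walk_sum token_step w - c \<in> nullhom"
    using nullhom_closed(2)[OF p(2), of "walk_sum token_step ?q + walk_sum token_step (rev ?q)"]
    by (simp add: algebra_simps)
  moreover have "based (rpow_verts V n) R M (walk_loop M w)"
    by (rule based_walk_loop[OF walk verts assms(2)])
  ultimately show thesis using that loop_chain_walk_loop[OF w] by simp
qed

section \<open>Injectivity and the isomorphism\<close>

lemma loop_chain_inj:
  assumes f: "based (rpow_verts V n) R M f" and g: "based (rpow_verts V n) R M g"
    and M: "M \<in> rpow_verts V n" and "loop_chain f - loop_chain g \<in> nullhom"
  shows "based_homotopic (rpow_verts V n) R M f g"
proof -
  have rf: "\<forall>i. \<bar>i\<bar> \<ge> int (rad M f) \<longrightarrow> f i = M" using rad_spec[OF f] by blast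
  have rg: "\<forall>i. \<bar>i\<bar> \<ge> int (rad M g) \<longrightarrow> g i = M" using rad_spec[OF g] by blast
  let ?w = "window (rad M f) f" and ?w' = "window (rad M g) g"
  note w = window_props[OF f rf] and w' = window_props[OF g rg]
  have "walk_homotopic R ?w ?w'"
    using homologous_imp_homotopic[OF w(1,5,2,3,4) w'(1,5,2,3,4)] assms(4)
    by (simp add: loop_chain_window[OF f rf] loop_chain_window[OF g rg])
  moreover have "walk R (M # [] @ ?w @ [] @ [M])"
    using walk_pad[OF w(1-4)] by simp
  ultimately have "based_homotopic (rpow_verts V n) R M (walk_loop M ?w) (walk_loop M ?w')"
    (is "based_homotopic _ _ _ ?f' ?g'")
    using symmetric_graph.walk_loop_homotopic[OF symmetric_graph_rpow _ M, of ?w ?w' "[]" "[]"] by simp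
  then have "based_homotopic (rpow_verts V n) R M f ?g'"
    by (rule based_homotopic_trans[OF based_homotopic_window[OF symp_rpow f rf]])
  then show ?thesis
    by (rule based_homotopic_trans[OF _ based_homotopic_sym[OF symp_rpow based_homotopic_window[OF
      symp_rpow g rg]]])
qed

lemma A1_iso_H1:
  assumes "M \<in> rpow_verts V n"
  shows "A1 (rpow_verts V n) R M \<cong> H1 V E"
proof -
  let ?W = "rpow_verts V n" and ?G = "A1 (rpow_verts V n) R M"
  let ?cls = "A1_class ?W R M"
  \<comment> \<open>The same choice as in the multiplication of \<open>A1\<close>, so that a product
    of classes unfolds to \<open>path_concat\<close> of these representatives.\<close>
  define rep where "rep X = (SOME f. f \<in> X)" for X :: "(int \<Rightarrow> 'a multiset) set"
  define \<Phi> where "\<Phi> X = hclass (loop_chain (rep X))" for X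
  have n0: "n > 0" using n by simp
  have rep: "based ?W R M (rep (?cls f)) \<and> based_homotopic ?W R M f (rep (?cls f))"
    if "based ?W R M f" for f
  proof -
    have "f \<in> ?cls f" using that based_homotopic_refl by (auto simp: A1_class_def)
    then have "rep (?cls f) \<in> ?cls f" unfolding rep_def by (rule someI[where P = "\<lambda>g. g \<in> ?cls f"])
    then show ?thesis by (simp add: A1_class_def)
  qed
  have \<Phi>: "\<Phi> (?cls f) = hclass (loop_chain f)" if "based ?W R M f" for f
  proof -
    have "loop_chain f - loop_chain (rep (?cls f)) \<in> nullhom"
      using rep[OF that] by (intro loop_chain_homotopic[OF _ n0]) blast
    then show ?thesis unfolding \<Phi>_def using hclass_eq_iff by metis
  qed
  have carrier: "carrier ?G = {?cls f | f. based ?W R M f}" by (simp add: A1_def)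
  have "\<Phi> \<in> hom ?G (H1 V E)"
  proof (rule homI)
    fix X Y assume "X \<in> carrier ?G" "Y \<in> carrier ?G"
    then have b: "based ?W R M (rep X)" "based ?W R M (rep Y)" using rep by (auto simp: carrier)
    have "X \<otimes>\<^bsub>?G\<^esub> Y = ?cls (path_concat M (rep X) (rep Y))" by (simp add: A1_def rep_def)
    then show "\<Phi> (X \<otimes>\<^bsub>?G\<^esub> Y) = \<Phi> X \<otimes>\<^bsub>H1 V E\<^esub> \<Phi> Y"
      using \<Phi>[OF based_path_concat[OF b]] by (simp add: loop_chain_concat[OF b] hclass_mult \<Phi>_def)
  qed (auto simp: carrier \<Phi> carrier_H1 loop_chain_cycle)
  moreover have "inj_on \<Phi> (carrier ?G)"
  proof (rule inj_onI)
    fix X Y assume "X \<in> carrier ?G" "Y \<in> carrier ?G" and eq: "\<Phi> X = \<Phi> Y"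
    then obtain f g where fg: "X = ?cls f" "based ?W R M f" "Y = ?cls g" "based ?W R M g"
      by (auto simp: carrier)
    have "loop_chain f - loop_chain g \<in> nullhom"
      using eq fg by (simp add: \<Phi> hclass_eq_iff)
    then show "X = Y"
      using loop_chain_inj[OF fg(2,4) assms] A1_class_eq_iff[OF symp_rpow fg(2,4)] fg(1,3) by simp
  qed
  moreover have "\<Phi> ` carrier ?G = carrier (H1 V E)"
  proof
    show "\<Phi> ` carrier ?G \<subseteq> carrier (H1 V E)"
      by (auto simp: carrier \<Phi> carrier_H1 loop_chain_cycle)
    show "carrier (H1 V E) \<subseteq> \<Phi> ` carrier ?G"
    proof
      fix X assume "X \<in> carrier (H1 V E)"
      then obtain c where c: "c \<in> cycles" "X = hclass c" by (auto simp: carrier_H1)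
      obtain f where f: "based ?W R M f" "loop_chain f - c \<in> nullhom"
        using cycle_homologous_loop[OF c(1) assms] by blast
      then have "X = \<Phi> (?cls f)" by (simp add: \<Phi> c(2) hclass_eq_iff[symmetric])
      then show "X \<in> \<Phi> ` carrier ?G" using f(1) by (auto simp: carrier)
    qed
  qed
  ultimately have "\<Phi> \<in> iso ?G (H1 V E)" by (simp add: iso_def bij_betw_def)
  then show ?thesis by (auto simp: is_iso_def)
qed

end

theorem theorem1p1:
  fixes V :: "'a set" and E :: "'a \<Rightarrow> 'a \<Rightarrow> bool" and n :: nat and M0 :: "'a multiset"
  assumes "sgraph V E" and "n \<ge> 2" and "M0 \<in> rpow_verts V n"
  shows "A1 (rpow_verts V n) (rpow_edge E) M0 \<cong> H1 V E"
proof -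
  \<comment> \<open>Any vertex can serve as the root; \<open>M0\<close> is nonempty and supplies
    one.\<close>
  obtain a where "a \<in># M0"
    using assms(2,3) by (cases M0) (auto simp: rpow_verts_def)
  then have "a \<in> V" using assms(3) by (auto simp: rpow_verts_def)
  then interpret token_graph V E a n using assms(1,2) by unfold_locales
  show ?thesis by (rule A1_iso_H1[OF assms(3)])
qed

end
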